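(* Let $\widetilde{\mathbf{x}}_t$, $t\in[0,t_{\max}]$, be the $\mathbb{R}^N$-valued isotropic variance-exploding process $d\widetilde{\mathbf{x}}_t=\sqrt{2q(t)q'(t)}\,d\boldsymbol{W}_t$ with $\widetilde{\mathbf{x}}_0=\mathbf{x}_0$ and $q(t)=\kappa t$, $\kappa>0$. Let $\sigma>0$, define $$\boldsymbol{A}_t:=\Big(\boldsymbol{I}+\frac{q(t)^2}{\sigma^2}\boldsymbol{L}_\delta\Big)^{-1/2},$$ and let $\mathbf{x}_t=\boldsymbol{A}_t\widetilde{\mathbf{x}}_t$. Then: 1. $\boldsymbol{A}_t$ has the same eigenvectors as $\boldsymbol{L}_\delta$ (the columns of $\boldsymbol{U}$), with eigenvalue in graph-Fourier mode $i$ equal to $$a_i(t)=\Big(1+\frac{\mu_i q(t)^2}{\sigma^2}\Big)^{-1/2}.$$ 2. For each fixed $t$, the graph-Fourier coefficients of $\mathbf{x}_t$ admit the representation $$x_{t,i}=a_i(t)\big(x_{0,i}+q(t)\epsilon_i\big),\qquad \epsilon_i:=[\boldsymbol{U}^\top\boldsymbol{\epsilon}]_i,\quad i=1,\dots,N,$$ where $\boldsymbol{\epsilon}\sim\mathcal{N}(\boldsymbol{0},\boldsymbol{I})$ (depending on $t$) is independent of $\mathbf{x}_0$; hence $\mathrm{Var}(x_{t,i}\mid x_{0,i})=a_i(t)^2q(t)^2$. 3. In conjugate coordinates, $\mathrm{Var}(\widetilde{x}_{t,i}\mid\widetilde{x}_{0,i})=q(t)^2$ for every mode $i$, so all graph-Fourier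 modes carry the same conditional noise variance.
   Context: Graph setting: $\mathcal{G}$ is a fixed undirected weighted graph on $N$ nodes with symmetric nonnegative adjacency matrix $\boldsymbol{W}$, diagonal degree matrix $\boldsymbol{D}$, $\boldsymbol{D}_{ii}=\sum_j\boldsymbol{W}_{ij}$, and symmetric normalized Laplacian $\boldsymbol{L}=\boldsymbol{I}-\boldsymbol{D}^{-1/2}\boldsymbol{W}\boldsymbol{D}^{-1/2}$, which is symmetric positive semidefinite with eigendecomposition $\boldsymbol{L}=\boldsymbol{U}\,\mathrm{diag}(\lambda_1,\dots,\lambda_N)\,\boldsymbol{U}^\top$, $\boldsymbol{U}^\top\boldsymbol{U}=\boldsymbol{I}$, $\lambda_i\ge 0$, and largest eigenvalue $\lambda_{\max}>0$. For a fixed $\delta>0$, the shifted normalized Laplacian is $\boldsymbol{L}_\delta=\boldsymbol{L}/\lambda_{\max}+\delta\boldsymbol{I}=\boldsymbol{U}\,\mathrm{diag}(\mu_1,\dots,\mu_N)\,\boldsymbol{U}^\top$ with $\mu_i=\lambda_i/\lambda_{\max}+\delta>0$. Notation: $\boldsymbol{W}_t$ (with time index) is a standard $N$-dimensional Brownian motion independent of the random initial signal $\mathbf{x}_0\in\mathbb{R}^N$. The $i$-th graph-Fourier coefficient of a vector is the $i$-th entry after multiplication by $\boldsymbol{U}^\top$: $x_{t,i}:=[\boldsymbol{U}^\top\mathbf{x}_t]_i$, $\widetilde{x}_{t,i}:=[\boldsymbol{U}^\top\widetilde{\mathbf{x}}_t]_i$. "Conjugate coordinates" refers to $\widetilde{\mathbf{x}}_t=\boldsymbol{A}_t^{-1}\mathbf{x}_t$.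 Conditional variances are variances of the conditional distribution. The inverse square root is that of a symmetric positive definite matrix. *)

theory Defs
  imports "HOL-Probability.Probability"
begin

subsection \<open>Symmetric matrices and spectra\<close>

definition is_eigenvector :: "real^'n^'n \<Rightarrow> real^'n \<Rightarrow> real \<Rightarrow> bool" where
  "is_eigenvector A v c \<longleftrightarrow> v \<noteq> 0 \<and> A *v v = c *\<^sub>R v"

definition diag_matrix :: "('n \<Rightarrow> real) \<Rightarrow> real^'n^'n" where
  "diag_matrix d = (\<chi> i j. if i = j then d i else 0)"

definition sym_pos_def :: "real^'n^'n \<Rightarrow> bool" where
  "sym_pos_def S \<longleftrightarrow> transpose S = S \<and> (\<forall>v. v \<noteq> 0 \<longrightarrow> v \<bullet> (S *v v) > 0)"

text \<open>The square root and the inverse square root are meaningful for symmetric positive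
  definite arguments, where the symmetric positive definite square root is unique.\<close>

definition spd_sqrt :: "real^'n^'n \<Rightarrow> real^'n^'n" where
  "spd_sqrt S = (THE R. sym_pos_def R \<and> R ** R = S)"

definition spd_inv_sqrt :: "real^'n^'n \<Rightarrow> real^'n^'n" where
  "spd_inv_sqrt S = matrix_inv (spd_sqrt S)"


subsection \<open>Weighted graphs\<close>

definition weighted_graph :: "real^'n^'n \<Rightarrow> bool" where
  "weighted_graph G \<longleftrightarrow> transpose G = G \<and> (\<forall>i j. 0 \<le> G $ i $ j)"

definition node_degree :: "real^'n^'n \<Rightarrow> 'n \<Rightarrow> real" where
  "node_degree G i = (\<Sum>j\<in>UNIV. G $ i $ j)"

text \<open>Since \<open>1 / sqrt 0 = 0\<close>, a node of degree zero gets the entry zero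
  in the inverse square root of the degree matrix.\<close>

definition normalized_laplacian :: "real^'n^'n \<Rightarrow> real^'n^'n" where
  "normalized_laplacian G =
     (let D' = diag_matrix (\<lambda>i. 1 / sqrt (node_degree G i)) in mat 1 - D' ** G ** D')"

definition max_eigenvalue :: "real^'n^'n \<Rightarrow> real" where
  "max_eigenvalue A = Max {c. \<exists>v. is_eigenvector A v c}"

definition shifted_laplacian :: "real \<Rightarrow> real^'n^'n \<Rightarrow> real^'n^'n" where
  "shifted_laplacian \<delta> G =
     (1 / max_eigenvalue (normalized_laplacian G)) *\<^sub>R normalized_laplacian G + \<delta> *\<^sub>R mat 1"

definition gft :: "real^'n^'n \<Rightarrow> real^'n \<Rightarrow> 'n \<Rightarrow> real" where
  "gft U v i = (transpose U *v v) $ i"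


subsection \<open>Brownian motion\<close>

text \<open>The law \<open>N(0, s\<^sup>2 I)\<close> on \<open>real^'n\<close>, for \<open>s > 0\<close>.\<close>

definition isotropic_normal :: "'a measure \<Rightarrow> real \<Rightarrow> ('a \<Rightarrow> real^'n) \<Rightarrow> bool" where
  "isotropic_normal M s X \<longleftrightarrow>
     distributed M lborel X (\<lambda>x. ennreal (\<Prod>i\<in>UNIV. normal_density 0 s (x $ i)))"

definition brownian_motion :: "'a measure \<Rightarrow> (real \<Rightarrow> 'a \<Rightarrow> real^'n) \<Rightarrow> bool" where
  "brownian_motion M B \<longleftrightarrow>
     (\<forall>t\<ge>0. B t \<in> borel_measurable M) \<and>
     (AE \<omega> in M. B 0 \<omega> = 0) \<and>
     (\<forall>m (\<tau> :: nat \<Rightarrow> real). 0 \<le> \<tau> 0 \<and> (\<forall>k<m. \<tau> k \<le> \<tau> (Suc k)) \<longrightarrow>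
        prob_space.indep_vars M (\<lambda>_. borel) (\<lambda>k \<omega>. B (\<tau> (Suc k)) \<omega> - B (\<tau> k) \<omega>) {..<m}) \<and>
     (\<forall>s t. 0 \<le> s \<and> s < t \<longrightarrow> isotropic_normal M (sqrt (t - s)) (\<lambda>\<omega>. B t \<omega> - B s \<omega>)) \<and>
     (AE \<omega> in M. continuous_on {0..} (\<lambda>t. B t \<omega>))"

text \<open>Independence of a random vector from the whole process: the product sigma-algebra on
  paths pulls back to the sigma-algebra generated by all \<open>B t\<close>, \<open>t \<ge> 0\<close>.\<close>

definition indep_of_process ::
    "'a measure \<Rightarrow> ('a \<Rightarrow> real^'n) \<Rightarrow> (real \<Rightarrow> 'a \<Rightarrow> real^'n) \<Rightarrow> bool" where
  "indep_of_process M \<xi> B \<longleftrightarrow>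
     \<xi> \<in> borel_measurable M \<and>
     prob_space.indep_set M
       {\<xi> -` C \<inter> space M | C. C \<in> sets borel}
       {(\<lambda>\<omega>. \<lambda>t\<in>{0..}. B t \<omega>) -` P \<inter> space M | P. P \<in> sets (Pi\<^sub>M {0..} (\<lambda>_. borel))}"


subsection \<open>Stochastic integrals of deterministic integrands\<close>

definition partition_upto :: "real \<Rightarrow> nat \<Rightarrow> (nat \<Rightarrow> real) \<Rightarrow> bool" where
  "partition_upto t m \<tau> \<longleftrightarrow> \<tau> 0 = 0 \<and> \<tau> m = t \<and> (\<forall>k<m. \<tau> k \<le> \<tau> (Suc k))"

definition step_fun :: "nat \<Rightarrow> (nat \<Rightarrow> real) \<Rightarrow> (nat \<Rightarrow> real) \<Rightarrow> real \<Rightarrow> real" where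
  "step_fun m \<tau> c s = (\<Sum>k<m. c k * indicator {\<tau> k<..\<tau> (Suc k)} s)"

definition step_integral ::
    "(real \<Rightarrow> 'a \<Rightarrow> real^'n) \<Rightarrow> nat \<Rightarrow> (nat \<Rightarrow> real) \<Rightarrow> (nat \<Rightarrow> real) \<Rightarrow> 'a \<Rightarrow> real^'n" where
  "step_integral B m \<tau> c \<omega> = (\<Sum>k<m. c k *\<^sub>R (B (\<tau> (Suc k)) \<omega> - B (\<tau> k) \<omega>))"

text \<open>\<open>J\<close> is a version of the Ito (Wiener) integral of the deterministic function \<open>f\<close> against
  \<open>B\<close> over \<open>[0, t]\<close>: the mean-square limit of the integrals of step functions that
  converge to \<open>f\<close> in \<open>L\<^sup>2[0, t]\<close>. By the Ito isometry the limit does not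
  depend, up to null sets, on the approximating sequence.\<close>

definition has_wiener_integral ::
    "'a measure \<Rightarrow> (real \<Rightarrow> 'a \<Rightarrow> real^'n) \<Rightarrow> (real \<Rightarrow> real) \<Rightarrow> real \<Rightarrow> ('a \<Rightarrow> real^'n) \<Rightarrow> bool" where
  "has_wiener_integral M B f t J \<longleftrightarrow>
     set_borel_measurable borel {0..t} f \<and> J \<in> borel_measurable M \<and>
     (\<exists>m \<tau> c. (\<forall>n. partition_upto t (m n) (\<tau> n)) \<and>
        (\<lambda>n. \<integral>\<^sup>+s\<in>{0..t}. ennreal ((step_fun (m n) (\<tau> n) (c n) s - f s)\<^sup>2) \<partial>lborel)
          \<longlonglongrightarrow> 0 \<and>
        (\<lambda>n. \<integral>\<^sup>+\<omega>. ennreal ((norm (step_integral B (m n) (\<tau> n) (c n) \<omega> - J \<omega>))\<^sup>2) \<partial>M)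
          \<longlonglongrightarrow> 0)"

text \<open>\<open>X\<close> solves \<open>dX\<^sub>t = g(t) dB\<^sub>t\<close> on \<open>[0, T]\<close> with initial value \<open>\<xi>\<close>.\<close>

definition solves_sde ::
    "'a measure \<Rightarrow> (real \<Rightarrow> 'a \<Rightarrow> real^'n) \<Rightarrow> (real \<Rightarrow> real) \<Rightarrow> real \<Rightarrow> ('a \<Rightarrow> real^'n)
      \<Rightarrow> (real \<Rightarrow> 'a \<Rightarrow> real^'n) \<Rightarrow> bool" where
  "solves_sde M B g T \<xi> X \<longleftrightarrow>
     (\<forall>t\<in>{0..T}. X t \<in> borel_measurable M) \<and>
     (AE \<omega> in M. X 0 \<omega> = \<xi> \<omega>) \<and>
     (AE \<omega> in M. continuous_on {0..T} (\<lambda>t. X t \<omega>)) \<and>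
     (\<forall>t\<in>{0..T}. has_wiener_integral M B g t (\<lambda>\<omega>. X t \<omega> - X 0 \<omega>))"


subsection \<open>Conditional variance\<close>

text \<open>\<open>K\<close> is a regular conditional distribution of \<open>Y\<close> given \<open>Z\<close>.\<close>

definition regular_cond_distr ::
    "'a measure \<Rightarrow> ('a \<Rightarrow> real) \<Rightarrow> ('a \<Rightarrow> real) \<Rightarrow> (real \<Rightarrow> real measure) \<Rightarrow> bool" where
  "regular_cond_distr M Y Z K \<longleftrightarrow>
     Y \<in> borel_measurable M \<and> Z \<in> borel_measurable M \<and> K \<in> borel \<rightarrow>\<^sub>M prob_algebra borel \<and>
     (\<forall>A\<in>sets borel. \<forall>C\<in>sets borel.
        emeasure M {\<omega> \<in> space M. Z \<omega> \<in> A \<and> Y \<omega> \<in> C}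
          = (\<integral>\<^sup>+z\<in>A. emeasure (K z) C \<partial>distr M borel Z))"

text \<open>\<open>Var(Y | Z = z) = v z\<close> for almost every \<open>z\<close>, as a variance of the conditional
  distribution; in particular no moments of the unconditional law of \<open>Y\<close> are required.\<close>

definition has_cond_variance ::
    "'a measure \<Rightarrow> ('a \<Rightarrow> real) \<Rightarrow> ('a \<Rightarrow> real) \<Rightarrow> (real \<Rightarrow> real) \<Rightarrow> bool" where
  "has_cond_variance M Y Z v \<longleftrightarrow>
     (\<exists>K. regular_cond_distr M Y Z K) \<and>
     (\<forall>K. regular_cond_distr M Y Z K \<longrightarrow>
        (AE z in distr M borel Z.
           integrable (K z) (\<lambda>y. y\<^sup>2) \<and> prob_space.variance (K z) (\<lambda>y. y) = v z))"

end

theory Submission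
  imports Defs
begin

text \<open>All matrices involved are functions of the Laplacian, hence diagonal in the basis \<open>U\<close>;
  positive definiteness of the square root pins it down mode by mode, and the Laplacian being
  positive semidefinite makes all \<open>\<mu>\<^sub>i\<close> positive.

  The noise \<open>X\<^sub>t - X\<^sub>0\<close> is a mean-square limit of step integrals, which are sums of
  independent isotropic Gaussian vectors and independent of \<open>x\<^sub>0\<close>. The Ito isometry identifies
  the limiting variance as \<open>\<integral>\<^sub>0\<^sup>t 2 q q' = q(t)\<^sup>2\<close>, and testing against bounded Lipschitz
  functions carries both the Gaussian law and the independence over to the limit. Conditionally on
  the initial coefficient, a graph-Fourier coefficient is then an affine image of an independent
  variable of mean \<open>0\<close> and variance \<open>1\<close>; since regular conditional distributions are
  almost surely unique, this determines the conditional variance.\<close>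

subsection \<open>Matrices diagonal in a fixed orthonormal basis\<close>

text \<open>Nothing is known about the law of \<open>x0\<close>, so conditional variances cannot be
  read off from unconditional second moments. Instead an explicit kernel is written down, the law of
  \<open>b * z + c * e\<close> for frozen \<open>z\<close>, and uniqueness extends the result to all
  other kernels, as \<open>has_cond_variance\<close> demands. Degenerate cases shape the Gaussian
  part. Partition points may repeat, sums may be empty and a limiting scale may be 0, so the family
  of laws has to contain the point mass. At \<open>t = 0\<close> the noise cannot be recovered by
  dividing \<open>X t - X 0\<close> by \<open>q t\<close>; a standard normal vector has to be
  supplied from elsewhere. On the matrix side \<open>spd_sqrt\<close> is a definite description and
  \<open>matrix_inv\<close> a choice. Neither says anything about \<open>A t\<close> before
  existence and uniqueness are shown, and for this every
  \<open>1 + \<mu> i * (q t)\<^sup>2 / \<sigma>\<^sup>2\<close> has to be positive.\<close>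

definition conj_diag :: "real^'n^'n \<Rightarrow> ('n \<Rightarrow> real) \<Rightarrow> real^'n^'n" where
  "conj_diag U d = U ** diag_matrix d ** transpose U"

lemma diag_matrix_mult_vec: "(diag_matrix d *v v) $ i = d i * v $ i"
  by (simp add: diag_matrix_def matrix_vector_mult_def if_distrib[of "\<lambda>x. x * _"] cong: if_cong)

lemma gft_add: "gft U (v + w) i = gft U v i + gft U w i"
  by (simp add: gft_def matrix_vector_right_distrib del: transpose_matrix_vector)

lemma gft_scaleR: "gft U (c *\<^sub>R v) i = c * gft U v i"
  by (simp add: gft_def matrix_vector_mult_scaleR del: transpose_matrix_vector)

lemma gft_eq_inner: "gft U v i = column i U \<bullet> v"
  by (simp add: gft_def matrix_vector_mult_def transpose_def column_def inner_vec_def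
      del: transpose_matrix_vector)

lemma gft_measurable [measurable]: "(\<lambda>v. gft U v i) \<in> borel_measurable borel"
  by (simp add: gft_eq_inner)

context
  fixes U :: "real^'n^'n"
  assumes U: "orthogonal_matrix U"
begin

lemma orthogonal_mult_transpose: "U ** transpose U = mat 1" "transpose U ** U = mat 1"
  using U by (auto simp: orthogonal_matrix_def)

lemma gft_column: "gft U (column j U) i = (if i = j then 1 else 0)"
proof -
  have "gft U (column j U) i = (transpose U ** U) $ i $ j"
    by (simp add: gft_def matrix_vector_mult_def matrix_matrix_mult_def column_def
        del: transpose_matrix_vector)
  then show ?thesis by (simp add: orthogonal_mult_transpose mat_def)
qed

lemma norm_column: "norm (column i U) = 1"
  using gft_column[of i i] by (simp add: gft_eq_inner norm_eq_1)

lemma gft_inject: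
  assumes "\<And>i. gft U v i = gft U w i" shows "v = w"
proof -
  have "transpose U *v v = transpose U *v w"
    using assms by (simp add: gft_def vec_eq_iff del: transpose_matrix_vector)
  then have "U *v (transpose U *v v) = U *v (transpose U *v w)" by simp
  then show ?thesis
    by (simp add: matrix_vector_mul_assoc orthogonal_mult_transpose del: transpose_matrix_vector)
qed

text \<open>Parseval's identity, from \<open>U ** transpose U = mat 1\<close>.\<close>

lemma inner_eq_sum_gft: "v \<bullet> w = (\<Sum>i\<in>UNIV. gft U v i * gft U w i)"
proof -
  have "v \<bullet> w = v \<bullet> (U *v (transpose U *v w))"
    by (simp add: matrix_vector_mul_assoc orthogonal_mult_transpose del: transpose_matrix_vector)
  also have "\<dots> = (transpose U *v v) \<bullet> (transpose U *v w)"
    by (simp add: dot_lmul_matrix[symmetric])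
  finally show ?thesis by (simp add: gft_def inner_vec_def del: transpose_matrix_vector)
qed

lemma gft_conj_diag: "gft U (conj_diag U d *v v) i = d i * gft U v i"
proof -
  have "transpose U *v (conj_diag U d *v v) =
      (transpose U ** U) *v (diag_matrix d *v (transpose U *v v))"
    by (simp add: conj_diag_def matrix_vector_mul_assoc matrix_mul_assoc
        del: transpose_matrix_vector)
  then show ?thesis
    by (simp add: gft_def orthogonal_mult_transpose diag_matrix_mult_vec
        del: transpose_matrix_vector)
qed

text \<open>The eigenvalue equation decouples into \<open>(d i - c) * gft U v i = 0\<close> for each
  mode. This form also covers eigenvectors mixing modes with equal \<open>d i\<close>, which allows
  the eigenvectors of two functions of one matrix to be compared.\<close>

lemma is_eigenvector_conj_diag:
  "is_eigenvector (conj_diag U d) v c \<longleftrightarrow> v \<noteq> 0 \<and> (\<forall>i. gft U v i \<noteq> 0 \<longrightarrow> d i = c)"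
proof -
  have "conj_diag U d *v v = c *\<^sub>R v \<longleftrightarrow> (\<forall>i. d i * gft U v i = c * gft U v i)"
    by (metis gft_conj_diag gft_inject gft_scaleR)
  then show ?thesis unfolding is_eigenvector_def by auto
qed

lemma column_eigenvector_conj_diag: "is_eigenvector (conj_diag U d) (column i U) (d i)"
  using norm_column[of i] by (auto simp: is_eigenvector_conj_diag gft_column split: if_splits)

text \<open>The columns of \<open>U\<close> form a basis and so determine \<open>S\<close>: the
  hypothesis is \<open>S ** U = U ** diag_matrix d\<close> read column by column, and
  \<open>transpose U\<close> cancels \<open>U\<close> on the right. Matrix identities become scalar
  ones, one per mode.\<close>

lemma conj_diag_eqI:
  assumes "\<And>i. S *v column i U = d i *\<^sub>R column i U"
  shows "S = conj_diag U d"
proof -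
  have "(S ** U) $ r $ i = (U ** diag_matrix d) $ r $ i" for r i
  proof -
    have "(S ** U) $ r $ i = (S *v column i U) $ r"
      by (simp add: matrix_matrix_mult_def matrix_vector_mult_def column_def)
    also have "\<dots> = (U ** diag_matrix d) $ r $ i"
      unfolding assms
      by (simp add: matrix_matrix_mult_def diag_matrix_def column_def mult.commute
          if_distrib[of "\<lambda>x. _ * x"] cong: if_cong)
    finally show ?thesis .
  qed
  then have "S ** U = U ** diag_matrix d" by (simp add: vec_eq_iff)
  then have "S ** (U ** transpose U) = conj_diag U d"
    by (simp add: conj_diag_def matrix_mul_assoc)
  then show ?thesis by (simp add: orthogonal_mult_transpose)
qed

lemma conj_diag_mult_column: "conj_diag U d *v column i U = d i *\<^sub>R column i U"
  using column_eigenvector_conj_diag by (simp add: is_eigenvector_def)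

lemma conj_diag_mult: "conj_diag U d ** conj_diag U e = conj_diag U (\<lambda>i. d i * e i)"
  by (rule conj_diag_eqI)
    (simp add: matrix_vector_mul_assoc[symmetric] conj_diag_mult_column matrix_vector_mult_scaleR
      mult.commute)

lemma conj_diag_affine:
  "b *\<^sub>R mat 1 + c *\<^sub>R conj_diag U d = conj_diag U (\<lambda>i. b + c * d i)"
  by (rule conj_diag_eqI)
    (simp add: matrix_vector_mult_add_rdistrib scaleR_matrix_vector_assoc[symmetric]
      conj_diag_mult_column scaleR_add_left)

lemma conj_diag_one: "conj_diag U (\<lambda>_. 1) = mat 1"
  by (rule conj_diag_eqI[symmetric]) simp

lemma sym_pos_def_conj_diag:
  assumes "\<And>i. 0 < d i"
  shows "sym_pos_def (conj_diag U d)"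
  unfolding sym_pos_def_def
proof (intro conjI allI impI)
  have "transpose (diag_matrix d) = diag_matrix d"
    by (simp add: transpose_def diag_matrix_def vec_eq_iff)
  then show "transpose (conj_diag U d) = conj_diag U d"
    by (simp add: conj_diag_def matrix_transpose_mul matrix_mul_assoc)
  fix v :: "real^'n" assume "v \<noteq> 0"
  then obtain j where "gft U v j \<noteq> 0"
    using gft_inject[of v 0] by (auto simp: gft_eq_inner)
  then have "0 < (\<Sum>i\<in>UNIV. d i * (gft U v i)\<^sup>2)"
    using assms by (intro sum_pos2[where i=j]) (auto simp: less_imp_le)
  then show "0 < v \<bullet> (conj_diag U d *v v)"
    by (simp add: inner_eq_sum_gft gft_conj_diag power2_eq_square mult_ac)
qed

text \<open>If \<open>R\<^sup>2 u = c\<^sup>2 u\<close>, then \<open>w = R u - c u\<close> satisfies \<open>R w = - c w\<close>, which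
  positive definiteness of \<open>R\<close> forbids unless \<open>w = 0\<close>.\<close>

lemma spd_sqrt_conj_diag:
  assumes d: "\<And>i. 0 < d i"
  shows "spd_sqrt (conj_diag U d) = conj_diag U (\<lambda>i. sqrt (d i))"
  unfolding spd_sqrt_def
proof (rule the_equality)
  show "sym_pos_def (conj_diag U (\<lambda>i. sqrt (d i))) \<and>
      conj_diag U (\<lambda>i. sqrt (d i)) ** conj_diag U (\<lambda>i. sqrt (d i)) = conj_diag U d"
    using d by (simp add: sym_pos_def_conj_diag conj_diag_mult less_imp_le)
next
  fix R assume R: "sym_pos_def R \<and> R ** R = conj_diag U d"
  show "R = conj_diag U (\<lambda>i. sqrt (d i))"
  proof (rule conj_diag_eqI)
    fix i
    define u where "u = column i U"
    define w where "w = R *v u - sqrt (d i) *\<^sub>R u"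
    have "R *v (R *v u) = d i *\<^sub>R u"
      using R by (simp add: matrix_vector_mul_assoc u_def conj_diag_mult_column)
    then have Rw: "R *v w = - sqrt (d i) *\<^sub>R w"
      using d[of i] by (simp add: w_def matrix_vector_mult_diff_distrib matrix_vector_mult_scaleR
          scaleR_diff_right)
    have "w = 0"
    proof (rule ccontr)
      assume "w \<noteq> 0"
      then have "0 < w \<bullet> (R *v w)" using R by (simp add: sym_pos_def_def)
      moreover have "w \<bullet> (R *v w) \<le> 0"
        using d[of i] by (simp add: Rw less_imp_le)
      ultimately show False by simp
    qed
    then show "R *v column i U = sqrt (d i) *\<^sub>R column i U" by (simp add: w_def u_def)
  qed
qed

lemma matrix_inv_conj_diag:
  assumes "\<And>i. d i \<noteq> 0"
  shows "matrix_inv (conj_diag U d) = conj_diag U (\<lambda>i. 1 / d i)"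
proof -
  let ?A = "conj_diag U d" and ?B = "conj_diag U (\<lambda>i. 1 / d i)"
  have AB: "?A ** ?B = mat 1" "?B ** ?A = mat 1"
    using assms by (simp_all add: conj_diag_mult conj_diag_one)
  \<comment> \<open>\<open>matrix_inv\<close> is a Hilbert choice, so its defining property is
    available only because \<open>?B\<close> witnesses an inverse; multiplying by \<open>?B\<close>
    then identifies the chosen matrix.\<close>
  then have "?A ** matrix_inv ?A = mat 1"
    using someI_ex[of "\<lambda>X. ?A ** X = mat 1 \<and> X ** ?A = mat 1"]
    unfolding matrix_inv_def by metis
  then have "?B ** (?A ** matrix_inv ?A) = ?B" by simp
  then show ?thesis by (simp add: matrix_mul_assoc AB)
qed

lemma spd_inv_sqrt_conj_diag:
  assumes "\<And>i. 0 < d i"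
  shows "spd_inv_sqrt (conj_diag U d) = conj_diag U (\<lambda>i. d i powr (- 1 / 2))"
proof -
  have "sqrt (d i) \<noteq> 0" "d i powr (- 1 / 2) = 1 / sqrt (d i)" for i
    using assms[of i] by (simp_all add: powr_minus_divide powr_half_sqrt)
  then show ?thesis
    unfolding spd_inv_sqrt_def spd_sqrt_conj_diag[OF assms] by (simp add: matrix_inv_conj_diag)
qed

end

subsection \<open>The normalized Laplacian\<close>

text \<open>Each weighted cross term is at most the mean of two squares. Symmetry of
  \<open>G\<close> makes the two resulting double sums equal, and each of their rows is controlled
  because \<open>r i\<close> is the inverse root of the row sum.\<close>

lemma normalized_laplacian_psd:
  assumes G: "weighted_graph G"
  shows "0 \<le> v \<bullet> (normalized_laplacian G *v v)"
proof -
  define r where "r i = 1 / sqrt (node_degree G i)" for i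
  have sym: "G $ i $ j = G $ j $ i" for i j
    using G unfolding weighted_graph_def by (metis (no_types, lifting) transpose_def vec_lambda_beta)
  have nn: "0 \<le> G $ i $ j" for i j using G by (simp add: weighted_graph_def)
  have deg: "0 \<le> node_degree G i" for i by (simp add: node_degree_def nn sum_nonneg)
  \<comment> \<open>Equality for positive degree. At a node of degree zero \<open>r i = 0\<close>,
    so the left side vanishes and only the inequality survives.\<close>
  have row: "(\<Sum>j\<in>UNIV. G $ i $ j * (r i * v $ i)\<^sup>2) \<le> (v $ i)\<^sup>2" for i
  proof -
    have "(\<Sum>j\<in>UNIV. G $ i $ j * (r i * v $ i)\<^sup>2) = node_degree G i * (r i)\<^sup>2 * (v $ i)\<^sup>2"
      by (simp add: node_degree_def sum_distrib_right power_mult_distrib mult.assoc)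
    also have "\<dots> \<le> 1 * (v $ i)\<^sup>2"
      using deg[of i] by (intro mult_right_mono) (auto simp: r_def power_divide)
    finally show ?thesis by simp
  qed
  have mvc: "(G *v w) $ i = (\<Sum>j\<in>UNIV. G $ i $ j * w $ j)" for w i
    by (simp add: matrix_vector_mult_def)
  have "v \<bullet> ((diag_matrix r ** G ** diag_matrix r) *v v)
      = (\<Sum>i\<in>UNIV. v $ i * (r i * (\<Sum>j\<in>UNIV. G $ i $ j * (r j * v $ j))))"
    by (simp add: matrix_vector_mul_assoc[symmetric] inner_vec_def diag_matrix_mult_vec mvc)
  also have "\<dots> = (\<Sum>i\<in>UNIV. \<Sum>j\<in>UNIV. G $ i $ j * ((r i * v $ i) * (r j * v $ j)))"
    by (simp add: sum_distrib_left mult_ac)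
  also have "\<dots> \<le> (\<Sum>i\<in>UNIV. \<Sum>j\<in>UNIV. G $ i $ j * (((r i * v $ i)\<^sup>2 + (r j * v $ j)\<^sup>2) / 2))"
  proof (intro sum_mono mult_left_mono nn)
    show "r i * v $ i * (r j * v $ j) \<le> ((r i * v $ i)\<^sup>2 + (r j * v $ j)\<^sup>2) / 2" for i j
      using sum_squares_bound[of "r i * v $ i" "r j * v $ j"] by simp
  qed
  also have "\<dots> = ((\<Sum>i\<in>UNIV. \<Sum>j\<in>UNIV. G $ i $ j * (r i * v $ i)\<^sup>2)
      + (\<Sum>i\<in>UNIV. \<Sum>j\<in>UNIV. G $ i $ j * (r j * v $ j)\<^sup>2)) / 2"
    by (simp add: sum.distrib sum_divide_distrib add_divide_distrib distrib_left)
  also have "(\<Sum>i\<in>UNIV. \<Sum>j\<in>UNIV. G $ i $ j * (r j * v $ j)\<^sup>2)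
      = (\<Sum>i\<in>UNIV. \<Sum>j\<in>UNIV. G $ i $ j * (r i * v $ i)\<^sup>2)"
    by (subst sum.swap) (simp add: sym)
  also have "((\<Sum>i\<in>UNIV. \<Sum>j\<in>UNIV. G $ i $ j * (r i * v $ i)\<^sup>2)
      + (\<Sum>i\<in>UNIV. \<Sum>j\<in>UNIV. G $ i $ j * (r i * v $ i)\<^sup>2)) / 2 \<le> (\<Sum>i\<in>UNIV. (v $ i)\<^sup>2)"
    using sum_mono[of UNIV, OF row] by simp
  also have "\<dots> = v \<bullet> v" by (simp add: inner_vec_def power2_eq_square)
  finally show ?thesis
    by (simp add: normalized_laplacian_def Let_def r_def matrix_vector_mult_diff_rdistrib
        inner_diff_right)
qed

lemma normalized_laplacian_eigenvalue_nonneg: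
  assumes "weighted_graph G" "is_eigenvector (normalized_laplacian G) v c"
  shows "0 \<le> c"
proof -
  have "0 \<le> c * (v \<bullet> v)" "0 < v \<bullet> v"
    using normalized_laplacian_psd[OF assms(1), of v] assms(2)
    by (simp_all add: is_eigenvector_def)
  then show ?thesis by (simp add: zero_le_mult_iff)
qed

subsection \<open>Isotropic normal laws\<close>

lemma Basis_vec_eq_range: "(Basis :: (real^'n) set) = range (\<lambda>i. axis i 1)"
  by (auto simp: Basis_vec_def)

lemma inj_axis: "inj (\<lambda>i. axis i (1::real))"
  by (auto simp: inj_on_def axis_eq_axis)

lemma prod_Basis_vec: "(\<Prod>b\<in>(Basis :: (real^'n) set). h b) = (\<Prod>i\<in>UNIV. h (axis i 1))"
  unfolding Basis_vec_eq_range by (subst prod.reindex[OF inj_axis]) simp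

lemma nn_integral_lborel_vec_prod:
  fixes f :: "'n::finite \<Rightarrow> real \<Rightarrow> ennreal"
  assumes [measurable]: "\<And>i. f i \<in> borel_measurable borel"
  shows "(\<integral>\<^sup>+x. (\<Prod>i\<in>UNIV. f i ((x :: real^'n) $ i)) \<partial>lborel) = (\<Prod>i\<in>UNIV. \<integral>\<^sup>+x. f i x \<partial>lborel)"
proof -
  \<comment> \<open>\<open>lborel\<close> factorizes over basis vectors rather than indices; the
    inverse of \<open>axis\<close> relabels the factors.\<close>
  define g where "g b = f (inv (\<lambda>i. axis i (1::real)) b)" for b
  have g: "g (axis i 1) = f i" for i
    unfolding g_def by (simp add: inv_f_f[OF inj_axis])
  have "(\<integral>\<^sup>+x. (\<Prod>b\<in>(Basis :: (real^'n) set). g b (x \<bullet> b)) \<partial>lborel)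
      = (\<Prod>b\<in>(Basis :: (real^'n) set). \<integral>\<^sup>+x. g b x \<partial>lborel)"
    by (rule nn_integral_lborel_prod) (simp_all add: g_def)
  then show ?thesis by (simp add: prod_Basis_vec g inner_axis)
qed

text \<open>Signed integrands need the Bochner form of Fubini on a product measure;
  \<open>lborel_eq\<close> presents \<open>lborel\<close> as the image of one under
  \<open>?T\<close>, the map from coordinates to vectors.\<close>

lemma
  fixes f :: "'n::finite \<Rightarrow> real \<Rightarrow> real"
  assumes f: "\<And>i. integrable lborel (f i)"
  shows integrable_lborel_vec_prod: "integrable lborel (\<lambda>x :: real^'n. \<Prod>i\<in>UNIV. f i (x $ i))"
    and integral_lborel_vec_prod: "(\<integral>x. (\<Prod>i\<in>UNIV. f i ((x :: real^'n) $ i)) \<partial>lborel) = (\<Prod>i\<in>UNIV. \<integral>x. f i x \<partial>lborel)"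
proof -
  interpret product_sigma_finite "\<lambda>_ :: real^'n. lborel :: real measure" ..
  let ?B = "Basis :: (real^'n) set"
  let ?T = "\<lambda>w :: real^'n \<Rightarrow> real. \<Sum>b\<in>?B. w b *\<^sub>R b"
  define g where "g b = f (inv (\<lambda>i. axis i (1::real)) b)" for b
  have g: "g (axis i 1) = f i" for i
    unfolding g_def by (simp add: inv_f_f[OF inj_axis])
  have [measurable]: "f i \<in> borel_measurable borel" for i using f[of i] by auto
  have T: "?T \<in> (\<Pi>\<^sub>M b\<in>?B. lborel) \<rightarrow>\<^sub>M borel" by measurable
  have "?T w $ i = w (axis i 1)" for w i
  proof -
    have "axis i 1 \<in> ?B" by (auto simp: Basis_vec_eq_range)
    then show ?thesis
      using inner_sum_left_Basis[of "axis i 1" w] by (simp add: inner_axis)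
  qed
  then have eq: "(\<Prod>i\<in>UNIV. f i (?T w $ i)) = (\<Prod>b\<in>?B. g b (w b))" for w
    by (simp add: prod_Basis_vec g)
  have gi: "integrable lborel (g b)" for b by (simp add: g_def f)
  have "integrable (\<Pi>\<^sub>M b\<in>?B. lborel) (\<lambda>w. \<Prod>b\<in>?B. g b (w b))"
    by (rule product_integrable_prod) (simp_all add: gi)
  then show "integrable lborel (\<lambda>x :: real^'n. \<Prod>i\<in>UNIV. f i (x $ i))"
    by (subst lborel_eq, subst integrable_distr_eq[OF T])
      (simp_all only: eq, measurable)
  have "(\<integral>w. (\<Prod>b\<in>?B. g b (w b)) \<partial>(\<Pi>\<^sub>M b\<in>?B. lborel)) = (\<Prod>b\<in>?B. integral\<^sup>L lborel (g b))"
    by (rule product_integral_prod) (simp_all add: gi)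
  then show "(\<integral>x. (\<Prod>i\<in>UNIV. f i ((x :: real^'n) $ i)) \<partial>lborel) = (\<Prod>i\<in>UNIV. \<integral>x. f i x \<partial>lborel)"
    by (subst lborel_eq, subst integral_distr[OF T])
      (simp_all only: eq prod_Basis_vec g, measurable)
qed

section \<open>Gaussian laws as a scaling family closed under convolution\<close>

definition normal_vec_density :: "real \<Rightarrow> real^'n \<Rightarrow> real" where
  "normal_vec_density s x = (\<Prod>i\<in>UNIV. normal_density 0 s (x $ i))"

text \<open>Defined by scaling rather than by a density so that the degenerate case \<open>s = 0\<close> is the
  point mass at the origin; \<open>s\<close> may be negative.\<close>

definition iso_law :: "real \<Rightarrow> (real^'n) measure" where
  "iso_law s = distr (density lborel (normal_vec_density 1)) borel (\<lambda>z. s *\<^sub>R z)"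

lemma normal_vec_density_measurable [measurable]: "normal_vec_density s \<in> borel_measurable borel"
  unfolding normal_vec_density_def by measurable

lemma normal_vec_density_nonneg: "0 \<le> normal_vec_density s x"
  by (simp add: normal_vec_density_def prod_nonneg)

lemma sets_iso_law [simp, measurable_cong]: "sets (iso_law s) = sets borel"
  by (simp add: iso_law_def)

lemma prob_space_normal_vec_density:
  "prob_space (density lborel (normal_vec_density 1 :: real^'n \<Rightarrow> real))"
proof -
  have "(\<integral>\<^sup>+x. ennreal (normal_density 0 1 x) \<partial>lborel) = 1"
    using prob_space.emeasure_space_1[OF prob_space_normal_density[of 1 0]]
    by (simp add: emeasure_density)
  then show ?thesis
    using nn_integral_lborel_vec_prod[of "\<lambda>_::'n. \<lambda>x. ennreal (normal_density 0 1 x)"]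
    by (intro prob_spaceI) (simp add: emeasure_density normal_vec_density_def prod_ennreal)
qed

lemma prob_space_iso_law: "prob_space (iso_law s)"
  unfolding iso_law_def by (rule prob_space.prob_space_distr[OF prob_space_normal_vec_density]) simp

lemma iso_law_zero: "iso_law 0 = return borel (0 :: real^'n)"
proof -
  interpret prob_space "density lborel (normal_vec_density 1 :: real^'n \<Rightarrow> real)"
    by (rule prob_space_normal_vec_density)
  have "(\<lambda>z :: real^'n. 0 *\<^sub>R z) = (\<lambda>_. 0)" by simp
  then show ?thesis unfolding iso_law_def by (simp only: distr_const) simp
qed

text \<open>Change of variables \<open>x = c *\<^sub>R z\<close>: the Jacobian
  \<open>\<bar>c\<bar> ^ CARD('n)\<close> is shared out among the coordinates, one factor for each
  one-dimensional density.\<close>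

lemma iso_law_eq_density:
  assumes c: "c \<noteq> 0"
  shows "iso_law c = density lborel (\<lambda>x :: real^'n. ennreal (normal_vec_density \<bar>c\<bar> x))"
proof -
  have *: "\<bar>c\<bar> ^ CARD('n) * normal_vec_density \<bar>c\<bar> (c *\<^sub>R z) = normal_vec_density 1 z"
    for z :: "real^'n"
  proof -
    have "\<bar>c\<bar> * normal_density 0 \<bar>c\<bar> (c * y) = normal_density 0 1 y" for y
      using c by (simp add: normal_density_def real_sqrt_mult power_mult_distrib)
    then have "(\<Prod>i\<in>UNIV. \<bar>c\<bar> * normal_density 0 \<bar>c\<bar> (c * z $ i)) = normal_vec_density 1 z"
      by (simp add: normal_vec_density_def)
    then show ?thesis by (simp add: normal_vec_density_def prod.distrib)
  qed
  have "density lborel (\<lambda>x :: real^'n. ennreal (normal_vec_density \<bar>c\<bar> x))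
      = density (density (distr lborel borel (\<lambda>x. 0 + c *\<^sub>R x)) (\<lambda>_. ennreal (\<bar>c\<bar> ^ CARD('n))))
          (\<lambda>x. ennreal (normal_vec_density \<bar>c\<bar> x))"
    using lborel_affine[OF c, of "0 :: real^'n"] by simp
  also have "\<dots> = density (distr lborel borel (\<lambda>x. c *\<^sub>R x))
      (\<lambda>x. ennreal (\<bar>c\<bar> ^ CARD('n) * normal_vec_density \<bar>c\<bar> x))"
    by (subst density_density_eq) (simp_all add: ennreal_mult normal_vec_density_nonneg)
  also have "\<dots> = iso_law c"
    unfolding iso_law_def by (subst density_distr) (simp_all add: *)
  finally show ?thesis by simp
qed

text \<open>Symmetry of centred normal laws. Coefficients of step functions may be negative, whereas
  the scales produced by convolution are square roots.\<close>

lemma iso_law_abs: "iso_law \<bar>c\<bar> = iso_law c"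
  by (cases "c = 0") (simp_all add: iso_law_eq_density)

lemma distr_iso_law_scaleR: "distr (iso_law s) borel (\<lambda>x. c *\<^sub>R x) = iso_law (c * s)"
  unfolding iso_law_def by (subst distr_distr) (simp_all add: o_def)

lemma isotropic_normal_iff:
  assumes "0 < s"
  shows "isotropic_normal M s X \<longleftrightarrow> X \<in> borel_measurable M \<and> distr M borel X = iso_law s"
proof -
  have "distr M lborel X = distr M borel X" by (rule distr_cong) simp_all
  then show ?thesis
    using assms unfolding isotropic_normal_def distributed_def
    by (auto simp: iso_law_eq_density normal_vec_density_def[abs_def])
qed

text \<open>The integrand factorizes over coordinates, which leaves the one-dimensional convolution
  formula in each of them.\<close>

lemma normal_vec_density_convolution:
  assumes "0 < s" "0 < t"
  shows "(\<integral>\<^sup>+y. ennreal (normal_vec_density s (x - y)) * ennreal (normal_vec_density t y) \<partial>lborel)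
      = ennreal (normal_vec_density (sqrt (s\<^sup>2 + t\<^sup>2)) x)"
proof -
  have "(\<integral>\<^sup>+y. ennreal (normal_vec_density s (x - y)) * ennreal (normal_vec_density t y) \<partial>lborel)
      = (\<integral>\<^sup>+y. (\<Prod>i\<in>UNIV. ennreal (normal_density 0 s (x $ i - y $ i) * normal_density 0 t (y $ i))) \<partial>lborel)"
    by (simp add: normal_vec_density_def prod_ennreal prod_nonneg prod.distrib flip: ennreal_mult)
  also have "\<dots> = (\<Prod>i\<in>UNIV. \<integral>\<^sup>+y. ennreal (normal_density 0 s (x $ i - y) * normal_density 0 t y) \<partial>lborel)"
    by (rule nn_integral_lborel_vec_prod) simp
  also have "\<dots> = (\<Prod>i\<in>UNIV. ennreal (normal_density 0 (sqrt (s\<^sup>2 + t\<^sup>2)) (x $ i)))"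
    using fun_cong[OF conv_normal_density_zero_mean[OF assms]] by simp
  finally show ?thesis by (simp add: normal_vec_density_def prod_ennreal)
qed

text \<open>Both laws have densities here, so translating the inner variable and exchanging the
  integrals reduces the claim to the convolution of densities.\<close>

lemma iso_law_convolution_pos:
  assumes st: "0 < s" "0 < t"
  shows "iso_law s \<star> iso_law t = (iso_law (sqrt (s\<^sup>2 + t\<^sup>2)) :: (real^'n) measure)"
proof (rule measure_eqI)
  let ?f = "\<lambda>x :: real^'n. ennreal (normal_vec_density s x)"
    and ?g = "\<lambda>x :: real^'n. ennreal (normal_vec_density t x)"
  have r: "sqrt (s\<^sup>2 + t\<^sup>2) \<noteq> 0" using st by (simp add: sum_power2_eq_zero_iff)
  have fin: "finite_measure (iso_law c)" for c
    using prob_space_iso_law by (rule prob_space.finite_measure)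
  fix A :: "(real^'n) set" assume "A \<in> sets (iso_law s \<star> iso_law t)"
  then have [measurable]: "A \<in> sets borel" by simp
  have shift: "(\<integral>\<^sup>+y. ?g y * indicator A (x + y) \<partial>lborel) = (\<integral>\<^sup>+y. ?g (y - x) * indicator A y \<partial>lborel)" for x
    by (subst (2) lborel_distr_plus[of x, symmetric], subst nn_integral_distr) simp_all
  have "emeasure (iso_law s \<star> iso_law t) A = (\<integral>\<^sup>+x. \<integral>\<^sup>+y. indicator A (x + y) \<partial>iso_law t \<partial>iso_law s)"
    by (simp add: convolution_emeasure' fin)
  also have "\<dots> = (\<integral>\<^sup>+x. ?f x * (\<integral>\<^sup>+y. ?g y * indicator A (x + y) \<partial>lborel) \<partial>lborel)"
    using st by (simp add: iso_law_eq_density nn_integral_density)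
  also have "\<dots> = (\<integral>\<^sup>+x. \<integral>\<^sup>+y. ?f x * (?g (y - x) * indicator A y) \<partial>lborel \<partial>lborel)"
    by (simp add: shift nn_integral_cmult)
  also have "\<dots> = (\<integral>\<^sup>+y. \<integral>\<^sup>+x. ?f x * (?g (y - x) * indicator A y) \<partial>lborel \<partial>lborel)"
    by (rule lborel_pair.Fubini') measurable
  also have "\<dots> = (\<integral>\<^sup>+y. (\<integral>\<^sup>+x. ?g (y - x) * ?f x \<partial>lborel) * indicator A y \<partial>lborel)"
    by (subst nn_integral_multc[symmetric]) (simp_all add: mult_ac)
  also have "\<dots> = emeasure (iso_law (sqrt (s\<^sup>2 + t\<^sup>2))) A"
    using st r by (simp add: normal_vec_density_convolution iso_law_eq_density[OF r] emeasure_density add.commute)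
  finally show "emeasure (iso_law s \<star> iso_law t) A = emeasure (iso_law (sqrt (s\<^sup>2 + t\<^sup>2))) A" .
qed simp

lemma iso_law_convolution:
  "iso_law s \<star> iso_law t = (iso_law (sqrt (s\<^sup>2 + t\<^sup>2)) :: (real^'n) measure)"
proof -
  have fin: "finite_measure (iso_law c)" for c
    using prob_space_iso_law by (rule prob_space.finite_measure)
  \<comment> \<open>The point mass has no density; it is the unit of convolution instead.\<close>
  have zero: "iso_law 0 \<star> iso_law c = (iso_law c :: (real^'n) measure)" for c
  proof (rule measure_eqI)
    interpret c: prob_space "iso_law c" by (rule prob_space_iso_law)
    fix A :: "(real^'n) set" assume "A \<in> sets (iso_law 0 \<star> iso_law c)"
    then have [measurable]: "A \<in> sets borel" by simp
    have "emeasure (iso_law 0 \<star> iso_law c) A = (\<integral>\<^sup>+x. \<integral>\<^sup>+y. indicator A (x + y) \<partial>iso_law c \<partial>iso_law 0)"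
      by (simp add: convolution_emeasure' fin)
    also have "\<dots> = emeasure (iso_law c) A"
      by (simp add: iso_law_zero nn_integral_return)
    finally show "emeasure (iso_law 0 \<star> iso_law c) A = emeasure (iso_law c) A" .
  qed simp
  consider "s = 0" | "t = 0" | "s \<noteq> 0" "t \<noteq> 0" by blast
  then show ?thesis
  proof cases
    case 1 then show ?thesis by (simp add: zero iso_law_abs)
  next
    case 2 then show ?thesis
      by (subst convolution_commutative) (simp_all add: zero iso_law_abs fin)
  next
    case 3
    then show ?thesis
      using iso_law_convolution_pos[of "\<bar>s\<bar>" "\<bar>t\<bar>"] by (simp add: iso_law_abs)
  qed
qed

lemma (in prob_space) distr_sum_iso_law:
  fixes X :: "'i \<Rightarrow> 'a \<Rightarrow> real^'n"
  assumes "finite I" and "indep_vars (\<lambda>_. borel) X I"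
    and "\<And>i. i \<in> I \<Longrightarrow> distr M borel (X i) = iso_law (s i)"
  shows "distr M borel (\<lambda>\<omega>. \<Sum>i\<in>I. X i \<omega>) = iso_law (sqrt (\<Sum>i\<in>I. (s i)\<^sup>2))"
  using assms
proof (induct I)
  case empty
  then show ?case by (simp add: iso_law_zero distr_const)
next
  case (insert i I)
  have rv [measurable]: "random_variable borel (X j)" if "j \<in> insert i I" for j
    using insert.prems(1) that by (auto simp: indep_vars_def)
  \<comment> \<open>Block independence: \<open>X i\<close> is independent of the tuple of the
    remaining variables, and their sum is a measurable function of that tuple.\<close>
  have "indep_var
      borel ((\<lambda>f. f i) \<circ> (\<lambda>\<omega>. restrict (\<lambda>j. X j \<omega>) {i}))
      borel ((\<lambda>f. \<Sum>j\<in>I. f j) \<circ> (\<lambda>\<omega>. restrict (\<lambda>j. X j \<omega>) I))"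
    using insert.hyps
    by (intro indep_var_compose[OF indep_var_restrict[OF insert.prems(1)]]) auto
  also have "(\<lambda>f. f i) \<circ> (\<lambda>\<omega>. restrict (\<lambda>j. X j \<omega>) {i}) = X i" by auto
  also have "(\<lambda>f. \<Sum>j\<in>I. f j) \<circ> (\<lambda>\<omega>. restrict (\<lambda>j. X j \<omega>) I) = (\<lambda>\<omega>. \<Sum>j\<in>I. X j \<omega>)"
    by (auto simp: fun_eq_iff)
  finally have ind: "indep_var borel (X i) borel (\<lambda>\<omega>. \<Sum>j\<in>I. X j \<omega>)" .
  have "distr M borel (\<lambda>\<omega>. \<Sum>j\<in>I. X j \<omega>) = iso_law (sqrt (\<Sum>j\<in>I. (s j)\<^sup>2))"
    using insert.prems by (intro insert.hyps(3)) (auto intro: indep_vars_subset)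
  then have "distr M borel (\<lambda>\<omega>. X i \<omega> + (\<Sum>j\<in>I. X j \<omega>))
      = (iso_law (s i) \<star> iso_law (sqrt (\<Sum>j\<in>I. (s j)\<^sup>2)))"
    using sum_indep_random_variable[OF ind] insert.prems(2) by simp
  then show ?case
    using insert.hyps by (simp add: iso_law_convolution sum_nonneg)
qed

section \<open>First and second moments of linear functionals\<close>

lemma
  fixes w :: "real^'n"
  shows integrable_iso_law_inner_square: "integrable (iso_law 1) (\<lambda>z. (w \<bullet> z)\<^sup>2)"
    and integral_iso_law_inner: "(\<integral>z. w \<bullet> z \<partial>iso_law 1) = 0"
    and integral_iso_law_inner_square: "(\<integral>z. (w \<bullet> z)\<^sup>2 \<partial>iso_law 1) = (norm w)\<^sup>2"
proof -
  let ?\<phi> = "normal_density 0 1"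
  have mom: "integrable lborel ?\<phi>" "integral\<^sup>L lborel ?\<phi> = 1"
    "integrable lborel (\<lambda>x. ?\<phi> x * x)" "(\<integral>x. ?\<phi> x * x \<partial>lborel) = 0"
    "integrable lborel (\<lambda>x. ?\<phi> x * (x * x))" "(\<integral>x. ?\<phi> x * (x * x) \<partial>lborel) = 1"
    using integrable_normal_moment_nz_1[of 1 0] integral_normal_moment_nz_1[of 1 0]
      integrable_std_normal_moment[of 2] integral_std_normal_moment_even[of 1]
    by (simp_all add: power2_eq_square)
  \<comment> \<open>The coordinate factors of
    \<open>normal_vec_density 1 x * (x $ j * x $ k)\<close>; at \<open>j = k\<close> the two
    conditionals multiply to the square.\<close>
  define f where "f j k i x = ?\<phi> x * ((if i = j then x else 1) * (if i = k then x else 1))"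
    for j k i :: 'n and x :: real
  have prod1: "(\<Prod>i\<in>UNIV. (if i = j then x $ i else 1)) = x $ j" for x :: "real^'n" and j
    by (simp add: prod.delta)
  have f_eq: "(\<Prod>i\<in>UNIV. f j k i (x $ i)) = normal_vec_density 1 x * (x $ j * x $ k)" for j k x
    by (simp add: f_def prod.distrib normal_vec_density_def prod1)
  have f_int: "integrable lborel (f j k i)" for j k i
    using mom unfolding f_def by (cases "i = j"; cases "i = k") simp_all
  \<comment> \<open>The integral vanishes exactly at a coordinate hit by only one of
    \<open>j\<close> and \<open>k\<close>, where it is a first moment. Hence mixed moments are 0,
    while for \<open>j = k\<close> every factor is 1.\<close>
  have f_val: "integral\<^sup>L lborel (f j k i) = (if (i = j) = (i = k) then 1 else 0)" for j k i
    using mom unfolding f_def by (cases "i = j"; cases "i = k") simp_all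
  have int2: "integrable lborel (\<lambda>x :: real^'n. normal_vec_density 1 x * (x $ j * x $ k))" for j k
    using integrable_lborel_vec_prod[of "f j k"] by (simp add: f_int f_eq)
  have val2: "(\<integral>x. normal_vec_density 1 x * ((x :: real^'n) $ j * x $ k) \<partial>lborel) = (if j = k then 1 else 0)"
    for j k
    using integral_lborel_vec_prod[of "f j k"]
    by (auto simp: f_int f_eq f_val intro!: prod_zero)
  define g where "g j i x = ?\<phi> x * (if i = j then x else 1)" for j i :: 'n and x :: real
  have g_eq: "(\<Prod>i\<in>UNIV. g j i (x $ i)) = normal_vec_density 1 x * x $ j" for j x
    by (simp add: g_def prod.distrib normal_vec_density_def prod1)
  have g_int: "integrable lborel (g j i)" for j i
    using mom unfolding g_def by (cases "i = j") simp_all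
  have int1: "integrable lborel (\<lambda>x :: real^'n. normal_vec_density 1 x * x $ j)" for j
    using integrable_lborel_vec_prod[of "g j"] by (simp add: g_int g_eq)
  have val1: "(\<integral>x. normal_vec_density 1 x * (x :: real^'n) $ j \<partial>lborel) = 0" for j
  proof -
    have "integral\<^sup>L lborel (g j j) = 0" using mom by (simp add: g_def[abs_def])
    then have "(\<Prod>i\<in>UNIV. integral\<^sup>L lborel (g j i)) = 0" by (auto intro!: prod_zero)
    then show ?thesis using integral_lborel_vec_prod[of "g j"] by (simp add: g_int g_eq)
  qed
  have N: "iso_law 1 = density lborel (\<lambda>x :: real^'n. ennreal (normal_vec_density 1 x))"
    using iso_law_eq_density[of 1] by simp
  have sq: "normal_vec_density 1 x * (w \<bullet> x)\<^sup>2
      = (\<Sum>j\<in>UNIV. \<Sum>k\<in>UNIV. (w $ j * w $ k) * (normal_vec_density 1 x * (x $ j * x $ k)))" for x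
    by (simp add: inner_vec_def power2_eq_square sum_product sum_distrib_left mult_ac)
  have lin: "normal_vec_density 1 x * (w \<bullet> x)
      = (\<Sum>j\<in>UNIV. w $ j * (normal_vec_density 1 x * x $ j))" for x
    by (simp add: inner_vec_def sum_distrib_left mult_ac)
  show "integrable (iso_law 1) (\<lambda>z. (w \<bullet> z)\<^sup>2)"
    unfolding N
    by (subst integrable_real_density) (simp_all add: normal_vec_density_nonneg sq int2)
  show "(\<integral>z. w \<bullet> z \<partial>iso_law 1) = 0"
    unfolding N
    by (subst integral_real_density) (simp_all add: normal_vec_density_nonneg lin int1 val1)
  show "(\<integral>z. (w \<bullet> z)\<^sup>2 \<partial>iso_law 1) = (norm w)\<^sup>2"
    unfolding N
    by (subst integral_real_density)
      (simp_all add: normal_vec_density_nonneg sq int2 val2 if_distrib[of "\<lambda>x. _ * x"]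
        power2_norm_eq_inner inner_vec_def[of w w] cong: if_cong)
qed

subsection \<open>Independence and limits in law\<close>

lemma Int_stable_vimage: "Int_stable {f -` A \<inter> \<Omega> | A. A \<in> sets N}"
proof (rule Int_stableI)
  fix a b assume "a \<in> {f -` A \<inter> \<Omega> | A. A \<in> sets N}" "b \<in> {f -` A \<inter> \<Omega> | A. A \<in> sets N}"
  then obtain A B where "A \<in> sets N" "B \<in> sets N" "a = f -` A \<inter> \<Omega>" "b = f -` B \<inter> \<Omega>" by auto
  then show "a \<inter> b \<in> {f -` A \<inter> \<Omega> | A. A \<in> sets N}"
    by (intro CollectI exI[of _ "A \<inter> B"]) auto
qed

context prob_space
begin

lemma indep_varI_generators:
  assumes [measurable]: "X \<in> M \<rightarrow>\<^sub>M S" "Y \<in> M \<rightarrow>\<^sub>M T"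
    and "indep_set {X -` A \<inter> space M | A. A \<in> sets S} {Y -` A \<inter> space M | A. A \<in> sets T}"
  shows "indep_var S X T Y"
  using assms by (simp add: indep_var_eq indep_set_sigma_sets Int_stable_vimage)

lemma indep_varI_measure:
  assumes [measurable]: "X \<in> M \<rightarrow>\<^sub>M S" "Y \<in> M \<rightarrow>\<^sub>M T"
    and "\<And>A C. A \<in> sets S \<Longrightarrow> C \<in> sets T \<Longrightarrow>
      prob {\<omega> \<in> space M. X \<omega> \<in> A \<and> Y \<omega> \<in> C} = measure (distr M S X) A * measure (distr M T Y) C"
  shows "indep_var S X T Y"
proof (rule indep_varI_generators)
  have "prob ((X -` A \<inter> space M) \<inter> (Y -` C \<inter> space M)) = prob (X -` A \<inter> space M) * prob (Y -` C \<inter> space M)"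
    if "A \<in> sets S" "C \<in> sets T" for A C
  proof -
    have "(X -` A \<inter> space M) \<inter> (Y -` C \<inter> space M) = {\<omega> \<in> space M. X \<omega> \<in> A \<and> Y \<omega> \<in> C}" by auto
    then show ?thesis using assms(3)[OF that] that by (simp add: measure_distr)
  qed
  then show "indep_set {X -` A \<inter> space M | A. A \<in> sets S} {Y -` A \<inter> space M | A. A \<in> sets T}"
    by (auto simp: indep_sets2_eq)
qed (fact assms)+

text \<open>The right side minus the left side is the variance of
  \<open>\<bar>Y \<omega>\<bar>\<close>.\<close>

lemma expectation_abs_square_le:
  fixes Y :: "'a \<Rightarrow> real"
  assumes "integrable M Y" "integrable M (\<lambda>\<omega>. (Y \<omega>)\<^sup>2)"
  shows "(expectation (\<lambda>\<omega>. \<bar>Y \<omega>\<bar>))\<^sup>2 \<le> expectation (\<lambda>\<omega>. (Y \<omega>)\<^sup>2)"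
  using variance_eq[of "\<lambda>\<omega>. \<bar>Y \<omega>\<bar>"] variance_positive[of "\<lambda>\<omega>. \<bar>Y \<omega>\<bar>"] assms by simp

text \<open>Mean-square convergence controls \<open>E|g(V\<^sub>n) - g(J)|\<close> directly when \<open>g\<close> is
  Lipschitz, so no almost surely convergent subsequence is needed.\<close>

lemma iso_law_limit_lipschitz:
  fixes V :: "nat \<Rightarrow> 'a \<Rightarrow> real^'n" and g :: "real^'n \<Rightarrow> real"
  assumes indep: "\<And>n. indep_var S \<xi> borel (V n)"
    and law: "\<And>n. distr M borel (V n) = iso_law (s n)" and s: "s \<longlonglongrightarrow> r"
    and J [measurable]: "J \<in> borel_measurable M"
    and L2: "(\<lambda>n. \<integral>\<^sup>+\<omega>. ennreal ((norm (V n \<omega> - J \<omega>))\<^sup>2) \<partial>M) \<longlonglongrightarrow> 0"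
    and g01: "\<And>x. 0 \<le> g x" "\<And>x. g x \<le> 1"
    and lip: "\<And>x y. \<bar>g x - g y\<bar> \<le> K * norm (x - y)" and K: "0 \<le> K"
    and C: "C \<in> sets S"
  shows "expectation (\<lambda>\<omega>. indicator C (\<xi> \<omega>) * g (J \<omega>))
      = measure (distr M S \<xi>) C * integral\<^sup>L (iso_law r) g"
\<comment> \<open>Both sides are limits of \<open>expectation (\<lambda>\<omega>. indicator C (\<xi>
  \<omega>) * g (V n \<omega>))\<close>: one by mean-square convergence, the other by independence
  and convergence of the scales.\<close>
proof (rule LIMSEQ_unique)
  have g_cont: "continuous_on UNIV g"
  proof (rule continuous_on_iff[THEN iffD2], safe)
    fix x :: "real^'n" and e :: real assume e: "0 < e"
    \<comment> \<open>\<open>K + 1\<close> instead of \<open>K\<close> keeps the radius meaningful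
      for \<open>K = 0\<close>.\<close>
    have "dist (g y) (g x) < e" if "dist y x < e / (K + 1)" for y
    proof -
      have "K * dist y x \<le> (K + 1) * dist y x" by (intro mult_right_mono) auto
      also have "\<dots> < e" using that K by (simp add: field_simps)
      finally show ?thesis using lip[of y x] by (simp add: dist_real_def dist_norm)
    qed
    then show "\<exists>d>0. \<forall>y\<in>UNIV. dist y x < d \<longrightarrow> dist (g y) (g x) < e"
      using e K by (intro exI[of _ "e / (K + 1)"]) auto
  qed
  then have g [measurable]: "g \<in> borel_measurable borel"
    by (rule borel_measurable_continuous_onI)
  have [measurable]: "V n \<in> borel_measurable M" and \<xi> [measurable]: "\<xi> \<in> M \<rightarrow>\<^sub>M S" for n
    using indep[of n] by (auto dest: indep_var_rv1 indep_var_rv2)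
  note [measurable] = C
  have abs_g: "\<bar>g x\<bar> \<le> 1" for x using g01[of x] by simp
  have int: "integrable M (\<lambda>\<omega>. h \<omega> * g (W \<omega>))"
    if [measurable]: "W \<in> borel_measurable M" "h \<in> borel_measurable M" and "\<And>\<omega>. \<bar>h \<omega>\<bar> \<le> 1"
    for W and h :: "'a \<Rightarrow> real"
    by (rule integrable_const_bound[where B=1])
      (use that abs_g in \<open>auto simp: abs_mult intro!: mult_le_one\<close>)
  have int1: "integrable M (\<lambda>\<omega>. g (W \<omega>))" if "W \<in> borel_measurable M" for W
    using int[OF that, of "\<lambda>_. 1"] by simp
  define Y where "Y n \<omega> = g (V n \<omega>) - g (J \<omega>)" for n \<omega>
  have Y1: "\<bar>Y n \<omega>\<bar> \<le> 1" for n \<omega>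
    using g01[of "V n \<omega>"] g01[of "J \<omega>"] by (simp add: Y_def abs_le_iff)
  have [measurable]: "Y n \<in> borel_measurable M" for n unfolding Y_def[abs_def] by measurable
  have intY: "integrable M (Y n)" "integrable M (\<lambda>\<omega>. (Y n \<omega>)\<^sup>2)" for n
    by (rule integrable_const_bound[where B=1]; use Y1 in \<open>auto simp: abs_square_le_1\<close>)+
  have "(\<lambda>n. \<integral>\<^sup>+\<omega>. ennreal ((Y n \<omega>)\<^sup>2) \<partial>M) \<longlonglongrightarrow> 0"
  proof (rule tendsto_sandwich[OF _ _ tendsto_const])
    show "(\<lambda>n. ennreal (K\<^sup>2) * (\<integral>\<^sup>+\<omega>. ennreal ((norm (V n \<omega> - J \<omega>))\<^sup>2) \<partial>M)) \<longlonglongrightarrow> 0"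
      using ennreal_tendsto_cmult[OF _ L2, of "ennreal (K\<^sup>2)"] by simp
    have "(Y n \<omega>)\<^sup>2 \<le> K\<^sup>2 * (norm (V n \<omega> - J \<omega>))\<^sup>2" for n \<omega>
      using power_mono[OF lip[of "V n \<omega>" "J \<omega>"], of 2] by (simp add: Y_def power_mult_distrib)
    then have "(\<integral>\<^sup>+\<omega>. ennreal ((Y n \<omega>)\<^sup>2) \<partial>M)
        \<le> (\<integral>\<^sup>+\<omega>. ennreal (K\<^sup>2) * ennreal ((norm (V n \<omega> - J \<omega>))\<^sup>2) \<partial>M)" for n
      by (intro nn_integral_mono) (simp flip: ennreal_mult)
    then show "\<forall>\<^sub>F n in sequentially. (\<integral>\<^sup>+\<omega>. ennreal ((Y n \<omega>)\<^sup>2) \<partial>M)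
        \<le> ennreal (K\<^sup>2) * (\<integral>\<^sup>+\<omega>. ennreal ((norm (V n \<omega> - J \<omega>))\<^sup>2) \<partial>M)"
      by (simp add: nn_integral_cmult)
  qed simp
  then have Y2: "(\<lambda>n. expectation (\<lambda>\<omega>. (Y n \<omega>)\<^sup>2)) \<longlonglongrightarrow> 0"
    by (subst (asm) nn_integral_eq_integral) (simp_all add: intY tendsto_ennreal_iff[of _ _ 0, simplified])
  have "(\<lambda>n. (expectation (\<lambda>\<omega>. \<bar>Y n \<omega>\<bar>))\<^sup>2) \<longlonglongrightarrow> 0"
    by (rule tendsto_sandwich[OF _ _ tendsto_const Y2])
      (simp_all add: expectation_abs_square_le intY)
  then have absY: "(\<lambda>n. expectation (\<lambda>\<omega>. \<bar>Y n \<omega>\<bar>)) \<longlonglongrightarrow> 0" by simp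
  have "(\<lambda>n. expectation (\<lambda>\<omega>. indicator C (\<xi> \<omega>) * g (V n \<omega>))
      - expectation (\<lambda>\<omega>. indicator C (\<xi> \<omega>) * g (J \<omega>))) \<longlonglongrightarrow> 0"
  proof (rule Lim_null_comparison[OF _ absY], rule always_eventually, rule allI)
    fix n
    have "expectation (\<lambda>\<omega>. indicator C (\<xi> \<omega>) * g (V n \<omega>))
        - expectation (\<lambda>\<omega>. indicator C (\<xi> \<omega>) * g (J \<omega>))
        = expectation (\<lambda>\<omega>. indicator C (\<xi> \<omega>) * Y n \<omega>)"
      by (subst Bochner_Integration.integral_diff[symmetric])
        (auto intro!: int simp: Y_def right_diff_distrib indicator_def)
    also have "norm \<dots> \<le> expectation (\<lambda>\<omega>. norm (indicator C (\<xi> \<omega>) * Y n \<omega>))"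
      by (rule integral_norm_bound)
    also have "\<dots> \<le> expectation (\<lambda>\<omega>. \<bar>Y n \<omega>\<bar>)"
      by (rule integral_mono') (auto simp: intY indicator_def)
    finally show "norm (expectation (\<lambda>\<omega>. indicator C (\<xi> \<omega>) * g (V n \<omega>))
        - expectation (\<lambda>\<omega>. indicator C (\<xi> \<omega>) * g (J \<omega>))) \<le> expectation (\<lambda>\<omega>. \<bar>Y n \<omega>\<bar>)" .
  qed
  then show "(\<lambda>n. expectation (\<lambda>\<omega>. indicator C (\<xi> \<omega>) * g (V n \<omega>)))
      \<longlonglongrightarrow> expectation (\<lambda>\<omega>. indicator C (\<xi> \<omega>) * g (J \<omega>))"
    by (rule LIM_zero_cancel)
  have E: "expectation (\<lambda>\<omega>. indicator C (\<xi> \<omega>) * g (V n \<omega>))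
      = measure (distr M S \<xi>) C * integral\<^sup>L (iso_law (s n)) g" for n
  proof -
    have "indep_var borel (indicator C \<circ> \<xi>) borel (g \<circ> V n)"
      by (rule indep_var_compose[OF indep]) measurable
    then have "indep_var borel (\<lambda>\<omega>. indicator C (\<xi> \<omega>)) borel (\<lambda>\<omega>. g (V n \<omega>))" by (simp add: o_def)
    moreover have "integrable M (\<lambda>\<omega>. indicator C (\<xi> \<omega>) :: real)"
      by (rule integrable_const_bound[where B=1]) auto
    ultimately have "expectation (\<lambda>\<omega>. indicator C (\<xi> \<omega>) * g (V n \<omega>))
        = expectation (\<lambda>\<omega>. indicator C (\<xi> \<omega>)) * expectation (\<lambda>\<omega>. g (V n \<omega>))"
      by (intro indep_var_lebesgue_integral int1) auto
    moreover have "expectation (\<lambda>\<omega>. indicator C (\<xi> \<omega>)) = measure (distr M S \<xi>) C"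
      using integral_distr[OF \<xi>, of "indicator C :: _ \<Rightarrow> real"] sets.sets_into_space[OF C]
      by (simp add: Int_absorb2)
    moreover have "expectation (\<lambda>\<omega>. g (V n \<omega>)) = integral\<^sup>L (iso_law (s n)) g"
      by (simp add: law[symmetric] integral_distr)
    ultimately show ?thesis by simp
  qed
  interpret N: prob_space "density lborel (normal_vec_density 1 :: real^'n \<Rightarrow> real)"
    by (rule prob_space_normal_vec_density)
  \<comment> \<open>All the laws are images of one Gaussian, so convergence of the scales gives
    pointwise convergence of the integrands under the bound 1, also when
    \<open>r = 0\<close>.\<close>
  have "(\<lambda>n. \<integral>z. g (s n *\<^sub>R z) \<partial>density lborel (normal_vec_density 1))
      \<longlonglongrightarrow> (\<integral>z. g (r *\<^sub>R z) \<partial>density lborel (normal_vec_density 1))"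
  proof (rule integral_dominated_convergence[where w="\<lambda>_. 1"])
    have "(\<lambda>n. g (s n *\<^sub>R z)) \<longlonglongrightarrow> g (r *\<^sub>R z)" for z
      by (rule continuous_on_tendsto_compose[OF g_cont]) (auto intro!: tendsto_scaleR s)
    then show "AE z in density lborel (normal_vec_density 1). (\<lambda>n. g (s n *\<^sub>R z)) \<longlonglongrightarrow> g (r *\<^sub>R z)"
      by simp
  qed (simp_all add: abs_g)
  then have "(\<lambda>n. integral\<^sup>L (iso_law (s n)) g) \<longlonglongrightarrow> integral\<^sup>L (iso_law r) g"
    by (simp add: iso_law_def integral_distr)
  then show "(\<lambda>n. expectation (\<lambda>\<omega>. indicator C (\<xi> \<omega>) * g (V n \<omega>)))
      \<longlonglongrightarrow> measure (distr M S \<xi>) C * integral\<^sup>L (iso_law r) g"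
    unfolding E by (rule tendsto_mult_left)
qed

text \<open>The cut-off functions \<open>max 0 (1 - real k * infdist x F)\<close> are Lipschitz with
  values between 0 and 1 and tend pointwise to the indicator of \<open>F\<close>, since points off a
  closed set have positive distance to it. Dominated convergence then carries the Lipschitz case
  over to \<open>F\<close>.\<close>

lemma iso_law_limit_closed:
  fixes V :: "nat \<Rightarrow> 'a \<Rightarrow> real^'n"
  assumes indep: "\<And>n. indep_var S \<xi> borel (V n)"
    and law: "\<And>n. distr M borel (V n) = iso_law (s n)" and s: "s \<longlonglongrightarrow> r"
    and J [measurable]: "J \<in> borel_measurable M"
    and L2: "(\<lambda>n. \<integral>\<^sup>+\<omega>. ennreal ((norm (V n \<omega> - J \<omega>))\<^sup>2) \<partial>M) \<longlonglongrightarrow> 0"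
    and C [measurable]: "C \<in> sets S" and F: "closed F"
  shows "prob {\<omega> \<in> space M. \<xi> \<omega> \<in> C \<and> J \<omega> \<in> F}
      = measure (distr M S \<xi>) C * measure (iso_law r) F"
\<comment> \<open>\<open>infdist\<close> to the empty set is 0 by convention, which would make every
  cut-off function constantly 1.\<close>
proof (cases "F = {}")
  case False
  have \<xi> [measurable]: "\<xi> \<in> M \<rightarrow>\<^sub>M S" using indep[of 0] by (rule indep_var_rv1)
  have [measurable]: "F \<in> sets borel" using F by (rule borel_closed)
  interpret r: prob_space "iso_law r" by (rule prob_space_iso_law)
  define g where "g k x = max 0 (1 - real k * infdist x F)" for k and x :: "real^'n"
  have g01: "0 \<le> g k x" "g k x \<le> 1" for k x by (auto simp: g_def infdist_nonneg)
  have lip: "\<bar>g k x - g k y\<bar> \<le> real k * norm (x - y)" for k x y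
  proof -
    have "\<bar>g k x - g k y\<bar> \<le> \<bar>real k * infdist x F - real k * infdist y F\<bar>"
      unfolding g_def by linarith
    also have "\<dots> = real k * \<bar>infdist x F - infdist y F\<bar>"
      by (simp add: abs_mult flip: right_diff_distrib)
    also have "\<dots> \<le> real k * norm (x - y)"
      using infdist_triangle_abs[of x F y] by (intro mult_left_mono) (auto simp: dist_norm)
    finally show ?thesis .
  qed
  have [measurable]: "g k \<in> borel_measurable borel" for k
    unfolding g_def[abs_def] by (intro borel_measurable_continuous_onI continuous_intros)
  have lim: "(\<lambda>k. g k x) \<longlonglongrightarrow> indicator F x" for x
  proof (cases "x \<in> F")
    case True then show ?thesis by (simp add: g_def)
  next
    case False
    then have pos: "0 < infdist x F" using F \<open>F \<noteq> {}\<close> by (simp add: infdist_pos_not_in_closed)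
    have "\<forall>\<^sub>F k in sequentially. 1 / infdist x F \<le> real k"
      using filterlim_real_sequentially by (auto simp: filterlim_at_top)
    then have "\<forall>\<^sub>F k in sequentially. g k x = 0"
      by eventually_elim (use pos in \<open>simp add: g_def field_simps\<close>)
    then show ?thesis using False by (auto intro: tendsto_eventually)
  qed
  have eq: "expectation (\<lambda>\<omega>. indicator C (\<xi> \<omega>) * g k (J \<omega>))
      = measure (distr M S \<xi>) C * integral\<^sup>L (iso_law r) (g k)" for k
    by (rule iso_law_limit_lipschitz[OF indep law s J L2 g01 lip]) (simp_all add: C)
  have "(\<lambda>k. expectation (\<lambda>\<omega>. indicator C (\<xi> \<omega>) * g k (J \<omega>)))
      \<longlonglongrightarrow> expectation (\<lambda>\<omega>. indicator C (\<xi> \<omega>) * indicator F (J \<omega>))"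
  proof (rule integral_dominated_convergence[where w="\<lambda>_. 1"])
    show "AE \<omega> in M. (\<lambda>k. indicator C (\<xi> \<omega>) * g k (J \<omega>)) \<longlonglongrightarrow> indicator C (\<xi> \<omega>) * indicator F (J \<omega>)"
      by (intro AE_I2 tendsto_mult_left lim)
  qed (use g01 in \<open>auto simp: indicator_def\<close>)
  moreover have "(\<lambda>k. integral\<^sup>L (iso_law r) (g k)) \<longlonglongrightarrow> integral\<^sup>L (iso_law r) (indicator F)"
    by (rule integral_dominated_convergence[where w="\<lambda>_. 1"]) (use g01 lim in auto)
  ultimately have "expectation (\<lambda>\<omega>. indicator C (\<xi> \<omega>) * indicator F (J \<omega>))
      = measure (distr M S \<xi>) C * integral\<^sup>L (iso_law r) (indicator F)"
    unfolding eq by (intro LIMSEQ_unique[OF _ tendsto_mult_left])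
  moreover have "(\<lambda>\<omega>. indicator C (\<xi> \<omega>) * indicator F (J \<omega>))
      = (indicator {\<omega>. \<xi> \<omega> \<in> C \<and> J \<omega> \<in> F} :: 'a \<Rightarrow> real)"
    by (auto simp: indicator_def)
  ultimately show ?thesis by (simp add: Collect_conj_eq Int_ac)
qed simp

text \<open>Closed sets are an intersection-stable generator of the Borel sets, so for fixed
  \<open>C\<close> the product formula extends from closed sets to all Borel sets \<open>A\<close>.
  Taking \<open>C = space S\<close> gives the law of \<open>J\<close>; once that is known, general
  \<open>C\<close> gives independence.\<close>

proposition iso_law_limit:
  fixes V :: "nat \<Rightarrow> 'a \<Rightarrow> real^'n"
  assumes indep: "\<And>n. indep_var S \<xi> borel (V n)"
    and law: "\<And>n. distr M borel (V n) = iso_law (s n)" and s: "s \<longlonglongrightarrow> r"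
    and J [measurable]: "J \<in> borel_measurable M"
    and L2: "(\<lambda>n. \<integral>\<^sup>+\<omega>. ennreal ((norm (V n \<omega> - J \<omega>))\<^sup>2) \<partial>M) \<longlonglongrightarrow> 0"
  shows "distr M borel J = iso_law r" "indep_var S \<xi> borel J"
proof -
  have \<xi> [measurable]: "\<xi> \<in> M \<rightarrow>\<^sub>M S" using indep[of 0] by (rule indep_var_rv1)
  interpret r: prob_space "iso_law r :: (real^'n) measure" by (rule prob_space_iso_law)
  have prod: "emeasure M {\<omega> \<in> space M. \<xi> \<omega> \<in> C \<and> J \<omega> \<in> A}
      = emeasure (distr M S \<xi>) C * emeasure (iso_law r) A"
    if C [measurable]: "C \<in> sets S" and A: "A \<in> sets borel" for C A
  proof -
    \<comment> \<open>Weighting \<open>M\<close> by the indicator of the event that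
      \<open>\<xi>\<close> lies in \<open>C\<close> turns the joint probability into a measure in
      \<open>A\<close> alone, to which the uniqueness theorem applies.\<close>
    define P where "P = distr (density M (indicator (\<xi> -` C \<inter> space M))) borel J"
    define Q where "Q = scale_measure (emeasure (distr M S \<xi>) C) (iso_law r :: (real^'n) measure)"
    have P: "emeasure P A = emeasure M {\<omega> \<in> space M. \<xi> \<omega> \<in> C \<and> J \<omega> \<in> A}"
      if [measurable]: "A \<in> sets borel" for A
    proof -
      have "emeasure P A = emeasure M ((\<xi> -` C \<inter> space M) \<inter> (J -` A \<inter> space M))"
        by (simp add: P_def emeasure_distr emeasure_density flip: indicator_inter_arith)
      also have "(\<xi> -` C \<inter> space M) \<inter> (J -` A \<inter> space M) = {\<omega> \<in> space M. \<xi> \<omega> \<in> C \<and> J \<omega> \<in> A}" by auto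
      finally show ?thesis .
    qed
    have Q: "emeasure Q A = emeasure (distr M S \<xi>) C * emeasure (iso_law r) A" for A
      by (simp add: Q_def)
    interpret D: prob_space "distr M S \<xi>" by (rule prob_space_distr) fact
    have "P = Q"
    proof (rule measure_eqI_generator_eq[where E="Collect closed" and \<Omega>=UNIV and A="\<lambda>_. UNIV"])
      fix F :: "(real^'n) set" assume "F \<in> Collect closed"
      then have "closed F" by simp
      then show "emeasure P F = emeasure Q F"
        using iso_law_limit_closed[OF indep law s J L2 C, of F]
        by (simp add: P Q borel_closed emeasure_eq_measure D.emeasure_eq_measure
            r.emeasure_eq_measure ennreal_mult)
    next
      have "sets borel = sigma_sets UNIV (Collect closed :: (real^'n) set set)"
        by (subst borel_eq_closed) simp
      then show "sets P = sigma_sets UNIV (Collect closed)" "sets Q = sigma_sets UNIV (Collect closed)"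
        by (simp_all add: P_def Q_def)
    qed (auto intro!: Int_stableI simp: P emeasure_eq_measure)
    then show ?thesis using P[OF A] Q[of A] by simp
  qed
  show law_J: "distr M borel J = iso_law r"
  proof (rule measure_eqI)
    fix A assume "A \<in> sets (distr M borel J)"
    then have A [measurable]: "A \<in> sets borel" by simp
    have "emeasure (distr M borel J) A = emeasure M {\<omega> \<in> space M. \<xi> \<omega> \<in> space S \<and> J \<omega> \<in> A}"
      using measurable_space[OF \<xi>] by (auto simp: emeasure_distr intro!: arg_cong[where f="emeasure M"])
    also have "\<dots> = emeasure (iso_law r) A"
      using prod[of "space S" A] A prob_space.emeasure_space_1[OF prob_space_distr[OF \<xi>]] by simp
    finally show "emeasure (distr M borel J) A = emeasure (iso_law r) A" .
  qed simp
  show "indep_var S \<xi> borel J"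
  proof (rule indep_varI_measure)
    fix A and C :: "(real^'n) set" assume "A \<in> sets S" "C \<in> sets borel"
    then show "prob {\<omega> \<in> space M. \<xi> \<omega> \<in> A \<and> J \<omega> \<in> C}
        = measure (distr M S \<xi>) A * measure (distr M borel J) C"
      using prod[of A C] by (simp add: measure_def law_J enn2real_mult)
  qed (fact \<xi> J)+
qed

end

subsection \<open>Wiener integrals of deterministic functions\<close>

lemma partition_mono:
  assumes "partition_upto t m \<tau>" "i \<le> j" "j \<le> m"
  shows "\<tau> i \<le> \<tau> j"
  using assms(2,3)
proof (induct j)
  case (Suc j)
  have "\<tau> j \<le> \<tau> (Suc j)" using assms(1) Suc.prems by (simp add: partition_upto_def)
  then show ?case using Suc by (cases "i = Suc j") auto
qed simp

lemma partition_nonneg: "partition_upto t m \<tau> \<Longrightarrow> k \<le> m \<Longrightarrow> 0 \<le> \<tau> k"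
  using partition_mono[of t m \<tau> 0 k] by (simp add: partition_upto_def)

lemma partition_le: "partition_upto t m \<tau> \<Longrightarrow> k \<le> m \<Longrightarrow> \<tau> k \<le> t"
  using partition_mono[of t m \<tau> k m] by (simp add: partition_upto_def)

text \<open>The half-open intervals of a monotone partition are pairwise disjoint, so all mixed
  products vanish.\<close>

lemma step_fun_square:
  assumes \<tau>: "partition_upto t m \<tau>"
  shows "(step_fun m \<tau> c s)\<^sup>2 = (\<Sum>k<m. (c k)\<^sup>2 * indicator {\<tau> k<..\<tau> (Suc k)} s)"
proof -
  let ?I = "\<lambda>k. indicator {\<tau> k<..\<tau> (Suc k)} s :: real"
  have disj: "?I k * ?I l = (if k = l then ?I k else 0)" if "k < m" "l < m" for k l
  proof -
    have "\<tau> (Suc i) \<le> \<tau> j" if "i < j" "j < m" for i j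
      using partition_mono[OF \<tau>, of "Suc i" j] that by simp
    from this[of k l] this[of l k] that
    have "\<not> (s \<in> {\<tau> k<..\<tau> (Suc k)} \<and> s \<in> {\<tau> l<..\<tau> (Suc l)})" if "k \<noteq> l"
      using that by (metis greaterThanAtMost_iff leD linorder_neqE_nat order.trans)
    then show ?thesis by (auto simp: indicator_def)
  qed
  have "(step_fun m \<tau> c s)\<^sup>2 = (\<Sum>k<m. \<Sum>l<m. (c k * c l) * (?I k * ?I l))"
    unfolding step_fun_def power2_eq_square sum_product by (simp only: mult_ac)
  also have "\<dots> = (\<Sum>k<m. \<Sum>l<m. (c k * c l) * (if k = l then ?I k else 0))"
    by (intro sum.cong refl) (simp add: disj)
  also have "\<dots> = (\<Sum>k<m. (c k)\<^sup>2 * ?I k)"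
    by (intro sum.cong refl) (simp add: if_distrib[of "\<lambda>x. _ * x"] power2_eq_square cong: if_cong)
  finally show ?thesis .
qed

lemma step_fun_measurable [measurable]: "step_fun m \<tau> c \<in> borel_measurable borel"
  unfolding step_fun_def[abs_def] by measurable

lemma
  assumes \<tau>: "partition_upto t m \<tau>"
  shows integrable_step_fun_square: "integrable lborel (\<lambda>s. (step_fun m \<tau> c s)\<^sup>2)"
    and integral_step_fun_square:
      "(\<integral>s. (step_fun m \<tau> c s)\<^sup>2 \<partial>lborel) = (\<Sum>k<m. (c k)\<^sup>2 * (\<tau> (Suc k) - \<tau> k))"
proof -
  have le: "\<tau> k \<le> \<tau> (Suc k)" if "k < m" for k using \<tau> that by (simp add: partition_upto_def)
  have int: "integrable lborel (\<lambda>s. (c k)\<^sup>2 * indicator {\<tau> k<..\<tau> (Suc k)} s)" if "k < m" for k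
    using le[OF that] by (intro integrable_mult_right integrable_real_indicator) auto
  show "integrable lborel (\<lambda>s. (step_fun m \<tau> c s)\<^sup>2)"
    unfolding step_fun_square[OF \<tau>] by (intro Bochner_Integration.integrable_sum int) simp
  show "(\<integral>s. (step_fun m \<tau> c s)\<^sup>2 \<partial>lborel) = (\<Sum>k<m. (c k)\<^sup>2 * (\<tau> (Suc k) - \<tau> k))"
    unfolding step_fun_square[OF \<tau>]
    by (subst Bochner_Integration.integral_sum) (use int le in auto)
qed

text \<open>All partition points lie between 0 and \<open>t\<close>. Hence the distance on
  \<open>{0..t}\<close> can be computed on the whole line against the integrand cut off to that
  interval.\<close>

lemma step_fun_outside: "partition_upto t m \<tau> \<Longrightarrow> s \<notin> {0..t} \<Longrightarrow> step_fun m \<tau> c s = 0"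
proof -
  assume \<tau>: "partition_upto t m \<tau>" and s: "s \<notin> {0..t}"
  have "s \<notin> {\<tau> k<..\<tau> (Suc k)}" if "k < m" for k
    using partition_nonneg[OF \<tau>, of k] partition_le[OF \<tau>, of "Suc k"] s that by auto
  then show ?thesis unfolding step_fun_def by (intro sum.neutral) auto
qed

text \<open>Continuity of the squared L2 norm, from the pointwise bound \<open>\<bar>f\<^sup>2 -
  h\<^sup>2\<bar> \<le> (1 + 1 / \<eta>) * (f - h)\<^sup>2 + \<eta> * h\<^sup>2\<close>: for fixed
  \<open>\<eta>\<close> the first term integrates to something tending to 0, and
  \<open>\<eta>\<close> is arbitrary.\<close>

lemma tendsto_integral_square:
  fixes f :: "nat \<Rightarrow> 'b \<Rightarrow> real" and h :: "'b \<Rightarrow> real"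
  assumes [measurable]: "h \<in> borel_measurable N" "\<And>n. f n \<in> borel_measurable N"
    and h2: "integrable N (\<lambda>s. (h s)\<^sup>2)" and f2: "\<And>n. integrable N (\<lambda>s. (f n s)\<^sup>2)"
    and lim: "(\<lambda>n. \<integral>\<^sup>+s. ennreal ((f n s - h s)\<^sup>2) \<partial>N) \<longlonglongrightarrow> 0"
  shows "(\<lambda>n. \<integral>s. (f n s)\<^sup>2 \<partial>N) \<longlonglongrightarrow> (\<integral>s. (h s)\<^sup>2 \<partial>N)"
proof -
  define d where "d n = (\<integral>s. (f n s - h s)\<^sup>2 \<partial>N)" for n
  define b where "b = (\<integral>s. (h s)\<^sup>2 \<partial>N)"
  have b: "0 \<le> b" unfolding b_def by simp
  have di: "integrable N (\<lambda>s. (f n s - h s)\<^sup>2)" for n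
  proof (rule Bochner_Integration.integrable_bound)
    show "integrable N (\<lambda>s. 2 * (f n s)\<^sup>2 + 2 * (h s)\<^sup>2)" using h2 f2 by simp
    have "(f n s - h s)\<^sup>2 \<le> 2 * (f n s)\<^sup>2 + 2 * (h s)\<^sup>2" for s
      using zero_le_power2[of "f n s + h s"] by (simp add: power2_eq_square algebra_simps)
    then show "AE s in N. norm ((f n s - h s)\<^sup>2) \<le> norm (2 * (f n s)\<^sup>2 + 2 * (h s)\<^sup>2)" by simp
  qed measurable
  have d: "d \<longlonglongrightarrow> 0"
    using lim by (subst (asm) nn_integral_eq_integral) (simp_all add: di d_def[abs_def] tendsto_ennreal_iff[of _ _ 0, simplified])
  have bound: "\<bar>(\<integral>s. (f n s)\<^sup>2 \<partial>N) - b\<bar> \<le> (1 + 1 / \<eta>) * d n + \<eta> * b" if \<eta>: "0 < \<eta>" for n \<eta>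
  proof -
    have pt: "\<bar>(f n s)\<^sup>2 - (h s)\<^sup>2\<bar> \<le> (1 + 1 / \<eta>) * (f n s - h s)\<^sup>2 + \<eta> * (h s)\<^sup>2" for s
    proof -
      define u where "u = f n s - h s"
      have eq: "(f n s)\<^sup>2 - (h s)\<^sup>2 = u\<^sup>2 + 2 * (u * h s)"
        by (simp add: u_def power2_eq_square algebra_simps)
      \<comment> \<open>Weighted Young inequality: expanding this square bounds the cross
        term.\<close>
      have "0 \<le> (\<bar>u\<bar> - \<eta> * \<bar>h s\<bar>)\<^sup>2 / \<eta>" using \<eta> by simp
      also have "\<dots> = u\<^sup>2 / \<eta> + \<eta> * (h s)\<^sup>2 - 2 * \<bar>u * h s\<bar>"
        using \<eta> by (simp add: power2_eq_square field_simps abs_mult)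
      finally have "2 * \<bar>u * h s\<bar> \<le> u\<^sup>2 / \<eta> + \<eta> * (h s)\<^sup>2" by simp
      then have "\<bar>u\<^sup>2 + 2 * (u * h s)\<bar> \<le> u\<^sup>2 + u\<^sup>2 / \<eta> + \<eta> * (h s)\<^sup>2"
        using abs_triangle_ineq[of "u\<^sup>2" "2 * (u * h s)"] by simp
      then show ?thesis by (simp add: eq distrib_right flip: u_def)
    qed
    have "\<bar>(\<integral>s. (f n s)\<^sup>2 \<partial>N) - b\<bar> = \<bar>\<integral>s. (f n s)\<^sup>2 - (h s)\<^sup>2 \<partial>N\<bar>"
      using h2 f2 by (simp add: b_def)
    also have "\<dots> \<le> (\<integral>s. \<bar>(f n s)\<^sup>2 - (h s)\<^sup>2\<bar> \<partial>N)" by (rule integral_abs_bound)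
    also have "\<dots> \<le> (\<integral>s. (1 + 1 / \<eta>) * (f n s - h s)\<^sup>2 + \<eta> * (h s)\<^sup>2 \<partial>N)"
      using h2 f2 di pt by (intro integral_mono) auto
    also have "\<dots> = (1 + 1 / \<eta>) * d n + \<eta> * b"
      using h2 di by (simp add: d_def b_def)
    finally show ?thesis .
  qed
  show ?thesis
  proof (rule LIMSEQ_I, fold b_def)
    fix \<epsilon> :: real assume \<epsilon>: "0 < \<epsilon>"
    \<comment> \<open>Chosen to make \<open>\<eta> * b < \<epsilon> / 2\<close>;
      \<open>b + 1\<close> avoids a division by zero at \<open>b = 0\<close>.\<close>
    define \<eta> where "\<eta> = \<epsilon> / (2 * (b + 1))"
    have \<eta>: "0 < \<eta>" using \<epsilon> b by (simp add: \<eta>_def)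
    have \<eta>b: "\<eta> * b < \<epsilon> / 2" using \<epsilon> b by (simp add: \<eta>_def field_simps)
    have "(\<lambda>n. (1 + 1 / \<eta>) * d n) \<longlonglongrightarrow> (1 + 1 / \<eta>) * 0"
      by (intro tendsto_intros d)
    then have "\<forall>\<^sub>F n in sequentially. (1 + 1 / \<eta>) * d n < \<epsilon> / 2"
      using \<epsilon> by (intro order_tendstoD(2)) auto
    then obtain n0 where n0: "\<And>n. n \<ge> n0 \<Longrightarrow> (1 + 1 / \<eta>) * d n < \<epsilon> / 2"
      by (auto simp: eventually_sequentially)
    then have "\<bar>(\<integral>s. (f n s)\<^sup>2 \<partial>N) - b\<bar> < \<epsilon>" if "n \<ge> n0" for n
      using bound[OF \<eta>, of n] \<eta>b n0[OF that] by linarith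
    then show "\<exists>n0. \<forall>n\<ge>n0. norm ((\<integral>s. (f n s)\<^sup>2 \<partial>N) - b) < \<epsilon>" by auto
  qed
qed

context prob_space
begin

lemma distr_step_integral:
  fixes B :: "real \<Rightarrow> 'a \<Rightarrow> real^'n"
  assumes B: "brownian_motion M B" and \<tau>: "partition_upto t m \<tau>"
  shows "distr M borel (step_integral B m \<tau> c)
    = iso_law (sqrt (\<Sum>k<m. (c k)\<^sup>2 * (\<tau> (Suc k) - \<tau> k)))"
proof -
  define X where "X k \<omega> = B (\<tau> (Suc k)) \<omega> - B (\<tau> k) \<omega>" for k \<omega>
  have le: "0 \<le> \<tau> k" "\<tau> k \<le> \<tau> (Suc k)" "0 \<le> \<tau> (Suc k)" if "k < m" for k
    using \<tau> that partition_nonneg[OF \<tau>] by (auto simp: partition_upto_def)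
  have Xm: "X k \<in> borel_measurable M" if "k < m" for k
    using B le[OF that] unfolding X_def[abs_def] brownian_motion_def
    by (intro borel_measurable_diff) auto
  have "0 \<le> \<tau> 0 \<and> (\<forall>k<m. \<tau> k \<le> \<tau> (Suc k))" using \<tau> by (simp add: partition_upto_def)
  then have "indep_vars (\<lambda>_. borel) X {..<m}"
    using B unfolding brownian_motion_def X_def[abs_def] by blast
  then have indep: "indep_vars (\<lambda>_. borel) (\<lambda>k \<omega>. c k *\<^sub>R X k \<omega>) {..<m}"
    by (rule indep_vars_compose2) simp
  have "distr M borel (\<lambda>\<omega>. c k *\<^sub>R X k \<omega>) = iso_law (c k * sqrt (\<tau> (Suc k) - \<tau> k))" if "k < m" for k
  proof -
    have "distr M borel (X k) = iso_law (sqrt (\<tau> (Suc k) - \<tau> k))"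
    \<comment> \<open>At a repeated partition point the increment is identically zero with law
      \<open>iso_law 0\<close>, beyond the reach of the density clause in
      \<open>brownian_motion\<close>.\<close>
    proof (cases "\<tau> k = \<tau> (Suc k)")
      case True
      then have "X k = (\<lambda>_. 0)" by (simp add: X_def fun_eq_iff)
      then show ?thesis using True by (simp add: iso_law_zero)
    next
      case False
      then show ?thesis
        using B le[OF that] unfolding brownian_motion_def X_def[abs_def]
        by (subst isotropic_normal_iff[THEN iffD1, THEN conjunct2]) auto
    qed
    then show ?thesis
      using distr_distr[of "\<lambda>x :: real^'n. c k *\<^sub>R x" borel borel "X k" M] Xm[OF that]
      by (simp add: distr_iso_law_scaleR o_def)
  qed
  then have "distr M borel (\<lambda>\<omega>. \<Sum>k<m. c k *\<^sub>R X k \<omega>)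
      = iso_law (sqrt (\<Sum>k<m. (c k * sqrt (\<tau> (Suc k) - \<tau> k))\<^sup>2))"
    by (intro distr_sum_iso_law indep) auto
  also have "(\<Sum>k<m. (c k * sqrt (\<tau> (Suc k) - \<tau> k))\<^sup>2) = (\<Sum>k<m. (c k)\<^sup>2 * (\<tau> (Suc k) - \<tau> k))"
    by (intro sum.cong refl) (use le in \<open>simp add: power_mult_distrib\<close>)
  finally show ?thesis by (simp add: step_integral_def[abs_def] X_def)
qed

text \<open>The step integral is a measurable function \<open>F\<close> of the path on
  \<open>{0..}\<close>, so the events it generates are among those of the path, from which
  \<open>\<xi>\<close> is independent by hypothesis.\<close>

lemma indep_var_step_integral:
  fixes B :: "real \<Rightarrow> 'a \<Rightarrow> real^'n"
  assumes B: "brownian_motion M B" and \<xi>: "indep_of_process M \<xi> B" and \<tau>: "partition_upto t m \<tau>"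
  shows "indep_var borel \<xi> borel (step_integral B m \<tau> c)"
proof -
  let ?path = "\<lambda>\<omega>. \<lambda>t\<in>{0..}. B t \<omega>"
  let ?\<Pi> = "Pi\<^sub>M {0..} (\<lambda>_. borel) :: (real \<Rightarrow> real^'n) measure"
  define F where "F p = (\<Sum>k<m. c k *\<^sub>R (p (\<tau> (Suc k)) - p (\<tau> k)))" for p :: "real \<Rightarrow> real^'n"
  have path: "?path \<in> M \<rightarrow>\<^sub>M ?\<Pi>"
    using B unfolding brownian_motion_def by (intro measurable_restrict) auto
  have F: "F \<in> ?\<Pi> \<rightarrow>\<^sub>M borel"
    using partition_nonneg[OF \<tau>] unfolding F_def[abs_def]
    by (intro borel_measurable_sum borel_measurable_scaleR borel_measurable_diff
        measurable_component_singleton) auto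
  have eq: "step_integral B m \<tau> c \<omega> = F (?path \<omega>)" for \<omega>
    using partition_nonneg[OF \<tau>] by (auto simp: step_integral_def F_def intro!: sum.cong)
  have sub: "{step_integral B m \<tau> c -` A \<inter> space M | A. A \<in> sets borel}
      \<subseteq> {?path -` P \<inter> space M | P. P \<in> sets ?\<Pi>}"
  proof safe
    fix A :: "(real^'n) set" assume "A \<in> sets borel"
    then show "\<exists>P. step_integral B m \<tau> c -` A \<inter> space M = ?path -` P \<inter> space M \<and> P \<in> sets ?\<Pi>"
      using measurable_space[OF path] measurable_sets[OF F]
      by (intro exI[of _ "F -` A \<inter> space ?\<Pi>"]) (auto simp: eq)
  qed
  show ?thesis
  proof (rule indep_varI_generators)
    show "\<xi> \<in> borel_measurable M" using \<xi> by (simp add: indep_of_process_def)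
    show "step_integral B m \<tau> c \<in> borel_measurable M"
      using measurable_compose[OF path F] by (simp add: eq[abs_def])
    show "indep_set {\<xi> -` A \<inter> space M | A. A \<in> sets borel}
        {step_integral B m \<tau> c -` A \<inter> space M | A. A \<in> sets borel}"
      using \<xi> unfolding indep_of_process_def indep_set_def
      by (elim conjE indep_sets_mono_sets) (use sub in \<open>simp split: bool.split\<close>)
  qed
qed

theorem wiener_integral_law:
  fixes B :: "real \<Rightarrow> 'a \<Rightarrow> real^'n"
  assumes B: "brownian_motion M B" and \<xi>: "indep_of_process M \<xi> B"
    and J: "has_wiener_integral M B f t J"
    and f2: "has_bochner_integral lborel (\<lambda>s. (f s)\<^sup>2 * indicator {0..t} s) v"
  shows "distr M borel J = iso_law (sqrt v)" "indep_var borel \<xi> borel J"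
proof -
  define h where "h s = f s * indicator {0..t} s" for s
  obtain m \<tau> c where \<tau>: "\<And>n. partition_upto t (m n) (\<tau> n)"
    and f: "(\<lambda>n. \<integral>\<^sup>+s\<in>{0..t}. ennreal ((step_fun (m n) (\<tau> n) (c n) s - f s)\<^sup>2) \<partial>lborel) \<longlonglongrightarrow> 0"
    and J2: "(\<lambda>n. \<integral>\<^sup>+\<omega>. ennreal ((norm (step_integral B (m n) (\<tau> n) (c n) \<omega> - J \<omega>))\<^sup>2) \<partial>M) \<longlonglongrightarrow> 0"
    and fm: "set_borel_measurable borel {0..t} f" and Jm: "J \<in> borel_measurable M"
    using J unfolding has_wiener_integral_def by blast
  have h: "h \<in> borel_measurable borel"
    using fm by (simp add: set_borel_measurable_def h_def[abs_def] mult.commute)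
  have h2: "has_bochner_integral lborel (\<lambda>s. (h s)\<^sup>2) v"
  proof -
    have "(h s)\<^sup>2 = (f s)\<^sup>2 * indicator {0..t} s" for s by (auto simp: h_def indicator_def)
    then show ?thesis using f2 by simp
  qed
  have "(step_fun (m n) (\<tau> n) (c n) s - h s)\<^sup>2
      = (step_fun (m n) (\<tau> n) (c n) s - f s)\<^sup>2 * indicator {0..t} s" for n s
    using step_fun_outside[OF \<tau>, of s] by (auto simp: h_def indicator_def)
  then have "(\<lambda>n. \<integral>\<^sup>+s. ennreal ((step_fun (m n) (\<tau> n) (c n) s - h s)\<^sup>2) \<partial>lborel) \<longlonglongrightarrow> 0"
    using f by (simp add: ennreal_mult' ennreal_indicator)
  then have "(\<lambda>n. \<integral>s. (step_fun (m n) (\<tau> n) (c n) s)\<^sup>2 \<partial>lborel) \<longlonglongrightarrow> (\<integral>s. (h s)\<^sup>2 \<partial>lborel)"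
    using h h2 integrable_step_fun_square[OF \<tau>]
    by (intro tendsto_integral_square) (auto simp: has_bochner_integral_iff)
  \<comment> \<open>Ito isometry: the sum under the root is both the integral of the squared step
    function and, by \<open>distr_step_integral\<close>, the squared scale of the step
    integral.\<close>
  then have "(\<lambda>n. sqrt (\<Sum>k<m n. (c n k)\<^sup>2 * (\<tau> n (Suc k) - \<tau> n k))) \<longlonglongrightarrow> sqrt v"
    using h2 by (intro tendsto_real_sqrt)
      (simp add: integral_step_fun_square[OF \<tau>] has_bochner_integral_iff)
  note lim = iso_law_limit[OF indep_var_step_integral[OF B \<xi> \<tau>] distr_step_integral[OF B \<tau>] this Jm J2]
  show "distr M borel J = iso_law (sqrt v)" "indep_var borel \<xi> borel J"
    by (rule lim)+
qed

end

subsection \<open>Conditional variances\<close>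

lemma regular_cond_distr_cong_AE:
  assumes [measurable]: "Y' \<in> borel_measurable M" "Z' \<in> borel_measurable M"
    and eq: "AE \<omega> in M. Y \<omega> = Y' \<omega>" "AE \<omega> in M. Z \<omega> = Z' \<omega>"
    and K: "regular_cond_distr M Y Z K"
  shows "regular_cond_distr M Y' Z' K"
proof -
  have [measurable]: "Y \<in> borel_measurable M" "Z \<in> borel_measurable M"
    using K by (simp_all add: regular_cond_distr_def)
  have "distr M borel Z = distr M borel Z'"
    by (intro distr_cong_AE) (use eq in simp_all)
  moreover have "emeasure M {\<omega> \<in> space M. Z \<omega> \<in> A \<and> Y \<omega> \<in> C}
      = emeasure M {\<omega> \<in> space M. Z' \<omega> \<in> A \<and> Y' \<omega> \<in> C}"
    if [measurable]: "A \<in> sets borel" "C \<in> sets borel" for A C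
    by (intro emeasure_eq_AE) (use eq in \<open>eventually_elim, auto\<close>)
  ultimately show ?thesis using K by (simp add: regular_cond_distr_def)
qed

text \<open>Almost surely equal pairs admit the same kernels. The equivalence is needed in both
  directions, because \<open>has_cond_variance\<close> asserts existence of a kernel as well as a
  property of all kernels.\<close>

lemma has_cond_variance_cong_AE:
  assumes [measurable]: "Y \<in> borel_measurable M" "Y' \<in> borel_measurable M"
      "Z \<in> borel_measurable M" "Z' \<in> borel_measurable M"
    and eq: "AE \<omega> in M. Y \<omega> = Y' \<omega>" "AE \<omega> in M. Z \<omega> = Z' \<omega>"
    and v: "has_cond_variance M Y' Z' v"
  shows "has_cond_variance M Y Z v"
proof -
  have "AE \<omega> in M. Y' \<omega> = Y \<omega>" "AE \<omega> in M. Z' \<omega> = Z \<omega>" using eq by (auto simp: eq_commute)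
  then have R: "regular_cond_distr M Y Z K \<longleftrightarrow> regular_cond_distr M Y' Z' K" for K
    using eq by (auto intro: regular_cond_distr_cong_AE[of Y' M Z' Y Z]
        regular_cond_distr_cong_AE[of Y M Z Y' Z'])
  have D: "distr M borel Z = distr M borel Z'"
    by (intro distr_cong_AE) (use eq in simp_all)
  show ?thesis using v unfolding has_cond_variance_def R D .
qed

text \<open>A countable generator, so that almost sure statements about its members can be combined:
  \<open>{..a}\<close> is the intersection of the rational half-lines above it.\<close>

lemma borel_eq_atMost_rat:
  "(borel :: real measure) = sigma UNIV (range (\<lambda>r::rat. {..real_of_rat r}))"
proof (rule borel_eq_sigmaI1[OF borel_eq_atMost])
  fix X :: "real set" assume "X \<in> range (\<lambda>a. {..a})"
  then obtain a where X: "X = {..a}" by auto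
  let ?R = "{r::rat. a < real_of_rat r}"
  have "X = (\<Inter>r\<in>?R. {..real_of_rat r})"
  proof (intro equalityI subsetI)
    fix x assume x: "x \<in> (\<Inter>r\<in>?R. {..real_of_rat r})"
    have "\<not> a < x"
    proof
      assume "a < x"
      then obtain r where "a < real_of_rat r" "real_of_rat r < x" using of_rat_dense by blast
      with x show False by force
    qed
    then show "x \<in> X" by (simp add: X)
  qed (use X in auto)
  moreover have "?R \<noteq> {}" using of_rat_dense[of a "a + 1"] by auto
  moreover have "(\<Inter>r\<in>?R. {..real_of_rat r})
      \<in> sets (sigma UNIV (range (\<lambda>r::rat. {..real_of_rat r})))"
    using \<open>?R \<noteq> {}\<close> by (intro sets.countable_INT') auto
  ultimately show "X \<in> sets (sigma UNIV (range (\<lambda>r::rat. {..real_of_rat r})))" by simp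
qed simp

context prob_space
begin

text \<open>For a fixed \<open>C\<close> both kernels are densities of the same measure, hence agree
  almost surely, but the null set depends on \<open>C\<close>. Countably many rational half-lines
  share one null set, and being intersection-stable they determine the measures \<open>K z\<close>
  and \<open>K' z\<close>.\<close>

lemma regular_cond_distr_unique:
  assumes K: "regular_cond_distr M Y Z K" and K': "regular_cond_distr M Y Z K'"
  shows "AE z in distr M borel Z. K z = K' z"
proof -
  have [measurable]: "Z \<in> borel_measurable M"
    and KM [measurable]: "K \<in> borel \<rightarrow>\<^sub>M prob_algebra borel" "K' \<in> borel \<rightarrow>\<^sub>M prob_algebra borel"
    using K K' by (simp_all add: regular_cond_distr_def)
  interpret Z: prob_space "distr M borel Z" by (rule prob_space_distr) measurable
  have sp: "sets (K z) = sets borel" "sets (K' z) = sets borel" "prob_space (K z)" "prob_space (K' z)"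
    for z using measurable_space[OF KM(1), of z] measurable_space[OF KM(2), of z]
    by (auto simp: space_prob_algebra)
  have eq: "AE z in distr M borel Z. emeasure (K z) C = emeasure (K' z) C"
    if [measurable]: "C \<in> sets borel" for C
  proof (rule Z.density_unique)
    have Km: "(\<lambda>z. emeasure (K z) C) \<in> borel_measurable borel"
      "(\<lambda>z. emeasure (K' z) C) \<in> borel_measurable borel"
      using measurable_prob_algebraD[OF KM(1)] measurable_prob_algebraD[OF KM(2)]
      by (auto intro: measurable_emeasure_kernel)
    then show "(\<lambda>z. emeasure (K z) C) \<in> borel_measurable (distr M borel Z)"
      "(\<lambda>z. emeasure (K' z) C) \<in> borel_measurable (distr M borel Z)" by simp_all
    show "density (distr M borel Z) (\<lambda>z. emeasure (K z) C)
        = density (distr M borel Z) (\<lambda>z. emeasure (K' z) C)"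
    proof (rule measure_eqI)
      fix A assume "A \<in> sets (density (distr M borel Z) (\<lambda>z. emeasure (K z) C))"
      then have "A \<in> sets borel" by simp
      then show "emeasure (density (distr M borel Z) (\<lambda>z. emeasure (K z) C)) A
          = emeasure (density (distr M borel Z) (\<lambda>z. emeasure (K' z) C)) A"
        using K K' Km that by (simp add: emeasure_density regular_cond_distr_def)
    qed simp
  qed
  have "AE z in distr M borel Z. \<forall>r::rat. emeasure (K z) {..real_of_rat r} = emeasure (K' z) {..real_of_rat r}"
    by (subst AE_all_countable) (simp add: eq)
  then show ?thesis
  proof eventually_elim
    fix z
    assume *: "\<forall>r::rat. emeasure (K z) {..real_of_rat r} = emeasure (K' z) {..real_of_rat r}"
    define E where "E = range (\<lambda>r::rat. {..real_of_rat r})"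
    show "K z = K' z"
    proof (rule measure_eqI_generator_eq[where E=E and \<Omega>=UNIV and A="\<lambda>n. {..real_of_rat (of_nat n)}"])
      show "Int_stable E"
      proof (rule Int_stableI)
        fix a b assume "a \<in> E" "b \<in> E"
        then obtain r s where "a = {..real_of_rat r}" "b = {..real_of_rat s}" by (auto simp: E_def)
        then have "a \<inter> b = {..real_of_rat (min r s)}" by (auto simp: min_def of_rat_less_eq)
        then show "a \<inter> b \<in> E" by (auto simp: E_def)
      qed
      have "sets borel = sigma_sets UNIV E"
        by (subst borel_eq_atMost_rat) (simp add: E_def)
      then show "sets (K z) = sigma_sets UNIV E" "sets (K' z) = sigma_sets UNIV E"
        by (simp_all add: sp)
      show "(\<Union>n. {..real_of_rat (of_nat n)}) = UNIV" by (auto intro: real_arch_simple)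
      interpret Kz: prob_space "K z" by (rule sp)
      show "emeasure (K z) {..real_of_rat (of_nat n)} \<noteq> \<infinity>" for n by simp
    qed (auto simp: E_def * simp del: of_rat_of_nat_eq)
  qed
qed

text \<open>By independence the joint law of \<open>Z\<close> and \<open>e\<close> is a product, so
  Tonelli shows that the law of \<open>b * z + c * e\<close> is a conditional distribution. Under it
  \<open>b * z\<close> is a constant shift, so its variance is that of \<open>c * e\<close>.\<close>

lemma has_cond_variance_affine:
  fixes Z e :: "'a \<Rightarrow> real"
  assumes indep: "indep_var borel Z borel e"
    and int: "integrable M (\<lambda>\<omega>. (e \<omega>)\<^sup>2)"
    and mean: "expectation e = 0" and var: "expectation (\<lambda>\<omega>. (e \<omega>)\<^sup>2) = s"
  shows "has_cond_variance M (\<lambda>\<omega>. b * Z \<omega> + c * e \<omega>) Z (\<lambda>_. c\<^sup>2 * s)"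
proof -
  have Z [measurable]: "Z \<in> borel_measurable M" and e [measurable]: "e \<in> borel_measurable M"
    using indep by (auto dest: indep_var_rv1 indep_var_rv2)
  define K where "K z = distr (distr M borel e) borel (\<lambda>y. b * z + c * y)" for z
  interpret E: prob_space "distr M borel e" by (rule prob_space_distr) measurable
  interpret Z: prob_space "distr M borel Z" by (rule prob_space_distr) measurable
  interpret ZE: pair_prob_space "distr M borel Z" "distr M borel e" ..
  have K: "regular_cond_distr M (\<lambda>\<omega>. b * Z \<omega> + c * e \<omega>) Z K"
    unfolding regular_cond_distr_def
  proof (intro conjI ballI)
    have "(\<lambda>_. distr M borel e) \<in> (borel :: real measure) \<rightarrow>\<^sub>M prob_algebra borel"
      by (rule measurable_const) (simp add: space_prob_algebra E.prob_space_axioms)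
    then show "K \<in> borel \<rightarrow>\<^sub>M prob_algebra borel" unfolding K_def by measurable
    fix A C :: "real set" assume [measurable]: "A \<in> sets borel" "C \<in> sets borel"
    define S where "S = {p \<in> space (borel \<Otimes>\<^sub>M borel :: (real \<times> real) measure).
        fst p \<in> A \<and> b * fst p + c * snd p \<in> C}"
    have [measurable]: "S \<in> sets (borel \<Otimes>\<^sub>M borel)" unfolding S_def by measurable
    have "{\<omega> \<in> space M. Z \<omega> \<in> A \<and> b * Z \<omega> + c * e \<omega> \<in> C} = (\<lambda>\<omega>. (Z \<omega>, e \<omega>)) -` S \<inter> space M"
      by (auto simp: S_def space_pair_measure)
    then have "emeasure M {\<omega> \<in> space M. Z \<omega> \<in> A \<and> b * Z \<omega> + c * e \<omega> \<in> C}
        = emeasure (distr M (borel \<Otimes>\<^sub>M borel) (\<lambda>\<omega>. (Z \<omega>, e \<omega>))) S"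
      by (simp add: emeasure_distr)
    also have "\<dots> = emeasure (distr M borel Z \<Otimes>\<^sub>M distr M borel e) S"
      using indep by (simp add: indep_var_distribution_eq)
    also have "\<dots> = (\<integral>\<^sup>+z. emeasure (distr M borel e) (Pair z -` S) \<partial>distr M borel Z)"
      by (intro E.emeasure_pair_measure_alt) (simp cong: sets_pair_measure_cong)
    also have "\<dots> = (\<integral>\<^sup>+z\<in>A. emeasure (K z) C \<partial>distr M borel Z)"
    proof (intro nn_integral_cong)
      fix z
      have "Pair z -` S = (if z \<in> A then (\<lambda>y. b * z + c * y) -` C else {})"
        by (auto simp: S_def space_pair_measure)
      then show "emeasure (distr M borel e) (Pair z -` S) = emeasure (K z) C * indicator A z"
        by (simp add: K_def emeasure_distr[of _ "distr M borel e"])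
    qed
    finally show "emeasure M {\<omega> \<in> space M. Z \<omega> \<in> A \<and> b * Z \<omega> + c * e \<omega> \<in> C}
        = (\<integral>\<^sup>+z\<in>A. emeasure (K z) C \<partial>distr M borel Z)" .
  qed measurable
  have Kz: "integrable (K z) (\<lambda>y. y\<^sup>2) \<and> prob_space.variance (K z) (\<lambda>y. y) = c\<^sup>2 * s" for z
  proof -
    have ie: "integrable M e" using int by (rule square_integrable_imp_integrable[rotated]) simp
    have int2: "integrable M (\<lambda>\<omega>. (b * z)\<^sup>2 + 2 * (b * z) * c * e \<omega> + c\<^sup>2 * (e \<omega>)\<^sup>2)"
      using ie int by (intro Bochner_Integration.integrable_add integrable_mult_right) auto
    have "integral\<^sup>L (K z) (\<lambda>y. y) = b * z"
      using ie mean by (simp add: K_def integral_distr prob_space)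
    moreover have "integrable (K z) (\<lambda>y. y\<^sup>2)"
      using int2 by (simp add: K_def integrable_distr_eq power2_eq_square algebra_simps)
    ultimately show ?thesis
      using var by (simp add: K_def integral_distr power_mult_distrib)
  qed
  show ?thesis
    unfolding has_cond_variance_def
  proof (intro conjI allI impI)
    fix K' assume "regular_cond_distr M (\<lambda>\<omega>. b * Z \<omega> + c * e \<omega>) Z K'"
    from regular_cond_distr_unique[OF K this]
    show "AE z in distr M borel Z. integrable (K' z) (\<lambda>y. y\<^sup>2) \<and>
        prob_space.variance (K' z) (\<lambda>y. y) = c\<^sup>2 * s"
      by (rule eventually_mono) (use Kz in metis)
  qed (use K in blast)
qed

end

subsection \<open>The variance-exploding process\<close>

lemma (in prob_space) variance_exploding_representation:
  fixes B :: "real \<Rightarrow> 'a \<Rightarrow> real^'n"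
  assumes B: "brownian_motion M B" and \<xi>: "indep_of_process M \<xi> B" and \<kappa>: "0 < \<kappa>"
    and sde: "solves_sde M B (\<lambda>s. sqrt (2 * (\<kappa> * s) * \<kappa>)) T \<xi> X" and t: "t \<in> {0..T}"
  obtains \<epsilon> where "isotropic_normal M 1 \<epsilon>" "indep_var borel \<xi> borel \<epsilon>"
    "AE \<omega> in M. X t \<omega> = \<xi> \<omega> + (\<kappa> * t) *\<^sub>R \<epsilon> \<omega>"
proof (cases "t = 0")
  case True
  \<comment> \<open>At \<open>t = 0\<close> the noise has coefficient 0, so any standard normal
    vector independent of \<open>\<xi>\<close> serves. The increment of \<open>B\<close> over the
    unit interval is one, written as a step integral over the partition 0, 1 given by
    \<open>real\<close>.\<close>
  have part: "partition_upto 1 1 real" by (simp add: partition_upto_def)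
  let ?\<epsilon> = "step_integral B 1 real (\<lambda>_. 1)"
  have ind: "indep_var borel \<xi> borel ?\<epsilon>" by (rule indep_var_step_integral[OF B \<xi> part])
  show thesis
  proof (rule that)
    show "isotropic_normal M 1 ?\<epsilon>"
      using distr_step_integral[OF B part, of "\<lambda>_. 1"] indep_var_rv2[OF ind]
      by (simp add: isotropic_normal_iff)
    show "AE \<omega> in M. X t \<omega> = \<xi> \<omega> + (\<kappa> * t) *\<^sub>R ?\<epsilon> \<omega>"
      using sde True by (simp add: solves_sde_def)
  qed (rule ind)
next
  case False
  then have t0: "0 < t" using t by simp
  define J where "J \<omega> = X t \<omega> - X 0 \<omega>" for \<omega>
  have W: "has_wiener_integral M B (\<lambda>s. sqrt (2 * (\<kappa> * s) * \<kappa>)) t J"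
    using sde t by (simp add: solves_sde_def J_def[abs_def])
  \<comment> \<open>The squared diffusion coefficient \<open>2 * q * q'\<close> is the derivative of
    \<open>q\<^sup>2\<close>, which explains the antiderivative.\<close>
  have "has_bochner_integral lborel (\<lambda>s. (2 * \<kappa>\<^sup>2 * s) * indicator {0..t} s) (\<kappa>\<^sup>2 * t\<^sup>2 - \<kappa>\<^sup>2 * 0\<^sup>2)"
    by (rule has_bochner_integral_FTC_Icc_real[where F="\<lambda>s. \<kappa>\<^sup>2 * s\<^sup>2"])
      (use t0 in \<open>auto intro!: derivative_eq_intros continuous_intros\<close>)
  \<comment> \<open>Squaring cancels the root only where the radicand is nonnegative, which the
    indicator guarantees.\<close>
  moreover have "(2 * \<kappa>\<^sup>2 * s) * indicator {0..t} s
      = (sqrt (2 * (\<kappa> * s) * \<kappa>))\<^sup>2 * indicator {0..t} s" for s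
    using \<kappa> by (simp add: indicator_def power2_eq_square)
  ultimately have I: "has_bochner_integral lborel
      (\<lambda>s. (sqrt (2 * (\<kappa> * s) * \<kappa>))\<^sup>2 * indicator {0..t} s) ((\<kappa> * t)\<^sup>2)"
    by (simp add: power_mult_distrib)
  note J = wiener_integral_law[OF B \<xi> W I]
  have Jm [measurable]: "J \<in> borel_measurable M" using J(2) by (rule indep_var_rv2)
  let ?\<epsilon> = "\<lambda>\<omega>. (1 / (\<kappa> * t)) *\<^sub>R J \<omega>"
  show thesis
  proof (rule that)
    have "distr M borel ?\<epsilon> = distr (distr M borel J) borel (\<lambda>x. (1 / (\<kappa> * t)) *\<^sub>R x)"
      by (subst distr_distr) (simp_all add: o_def)
    then show "isotropic_normal M 1 ?\<epsilon>"
      using \<kappa> t0 by (simp add: isotropic_normal_iff J(1) distr_iso_law_scaleR)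
    show "indep_var borel \<xi> borel ?\<epsilon>"
      using indep_var_compose[OF J(2), of id borel "\<lambda>x. (1 / (\<kappa> * t)) *\<^sub>R x" borel]
      by (simp add: o_def)
    have "AE \<omega> in M. X 0 \<omega> = \<xi> \<omega>" using sde by (simp add: solves_sde_def)
    then show "AE \<omega> in M. X t \<omega> = \<xi> \<omega> + (\<kappa> * t) *\<^sub>R ?\<epsilon> \<omega>"
      by eventually_elim (use \<kappa> t0 in \<open>simp add: J_def\<close>)
  qed
qed

text \<open>A graph-Fourier coefficient of \<open>\<epsilon>\<close> is its projection on the unit
  vector \<open>column i U\<close>. Isotropy gives every such projection mean 0 and variance 1, so
  the noise level is the same in all modes.\<close>

lemma (in prob_space) has_cond_variance_gft:
  fixes U :: "real^'n^'n"
  assumes U: "orthogonal_matrix U" and \<epsilon>: "isotropic_normal M 1 \<epsilon>"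
    and indep: "indep_var borel \<xi> borel \<epsilon>"
  shows "has_cond_variance M (\<lambda>\<omega>. b * gft U (\<xi> \<omega>) i + c * gft U (\<epsilon> \<omega>) i)
    (\<lambda>\<omega>. gft U (\<xi> \<omega>) i) (\<lambda>_. c\<^sup>2)"
proof -
  have \<epsilon>m [measurable]: "\<epsilon> \<in> borel_measurable M" and law: "distr M borel \<epsilon> = iso_law 1"
    using \<epsilon> by (simp_all add: isotropic_normal_iff)
  let ?w = "column i U"
  have "indep_var borel (\<lambda>\<omega>. gft U (\<xi> \<omega>) i) borel (\<lambda>\<omega>. gft U (\<epsilon> \<omega>) i)"
    using indep_var_compose[OF indep gft_measurable gft_measurable] by (simp add: o_def)
  moreover have "integrable M (\<lambda>\<omega>. (gft U (\<epsilon> \<omega>) i)\<^sup>2)"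
    using integrable_iso_law_inner_square[of ?w]
    by (simp add: gft_eq_inner integrable_distr_eq flip: law)
  moreover have "expectation (\<lambda>\<omega>. gft U (\<epsilon> \<omega>) i) = 0"
    using integral_iso_law_inner[of ?w] by (simp add: gft_eq_inner integral_distr flip: law)
  moreover have "expectation (\<lambda>\<omega>. (gft U (\<epsilon> \<omega>) i)\<^sup>2) = 1"
    using integral_iso_law_inner_square[of ?w]
    by (simp add: gft_eq_inner integral_distr norm_column[OF U] flip: law)
  ultimately show ?thesis
    using has_cond_variance_affine[of "\<lambda>\<omega>. gft U (\<xi> \<omega>) i" "\<lambda>\<omega>. gft U (\<epsilon> \<omega>) i" 1 b c] by simp
qed

text \<open>Eigenvectors are compared beyond the columns of \<open>U\<close>, since repeated
  eigenvalues allow eigenvectors that mix modes. The converse inclusion is confined to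
  \<open>0 < t\<close> because \<open>A 0\<close> is the identity, which has every nonzero vector as
  an eigenvector.\<close>

theorem proposition1:
  fixes G U :: "real^'n^'n" and lam \<mu> :: "'n \<Rightarrow> real"
    and M :: "'a measure" and B :: "real \<Rightarrow> 'a \<Rightarrow> real^'n" and x0 :: "'a \<Rightarrow> real^'n"
    and xt x :: "real \<Rightarrow> 'a \<Rightarrow> real^'n"
    and q :: "real \<Rightarrow> real" and A :: "real \<Rightarrow> real^'n^'n" and a :: "'n \<Rightarrow> real \<Rightarrow> real"
    and \<delta> \<kappa> \<sigma> t_max :: real
  assumes graph: "weighted_graph G"
    and U: "orthogonal_matrix U"
    and eigendecomposition:
      "normalized_laplacian G = U ** diag_matrix lam ** transpose U"
    and lam_max: "0 < max_eigenvalue (normalized_laplacian G)"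
    and \<delta>: "0 < \<delta>"
    and \<mu>: "\<And>i. \<mu> i = lam i / max_eigenvalue (normalized_laplacian G) + \<delta>"
    and M: "prob_space M"
    and B: "brownian_motion M B"
    and x0: "indep_of_process M x0 B"
    and t_max: "0 \<le> t_max"
    and \<kappa>: "0 < \<kappa>"
    and q: "\<And>t. q t = \<kappa> * t"
    and sde: "solves_sde M B (\<lambda>t. sqrt (2 * q t * deriv q t)) t_max x0 xt"
    and \<sigma>: "0 < \<sigma>"
    and A: "\<And>t. A t = spd_inv_sqrt (mat 1 + ((q t)\<^sup>2 / \<sigma>\<^sup>2) *\<^sub>R shifted_laplacian \<delta> G)"
    and x: "\<And>t \<omega>. x t \<omega> = A t *v xt t \<omega>"
    and a: "\<And>i t. a i t = (1 + \<mu> i * (q t)\<^sup>2 / \<sigma>\<^sup>2) powr (- 1 / 2)"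
  shows
    "(\<forall>t\<in>{0..t_max}.
       (\<forall>i. is_eigenvector (shifted_laplacian \<delta> G) (column i U) (\<mu> i) \<and>
            is_eigenvector (A t) (column i U) (a i t)) \<and>
       (\<forall>v. (\<exists>c. is_eigenvector (shifted_laplacian \<delta> G) v c) \<longrightarrow> (\<exists>c. is_eigenvector (A t) v c)) \<and>
       (0 < t \<longrightarrow>
         (\<forall>v. (\<exists>c. is_eigenvector (A t) v c) \<longrightarrow> (\<exists>c. is_eigenvector (shifted_laplacian \<delta> G) v c)))) \<and>
     (\<forall>t\<in>{0..t_max}.
       (\<exists>\<epsilon> :: 'a \<Rightarrow> real^'n.
          isotropic_normal M 1 \<epsilon> \<and> prob_space.indep_var M borel x0 borel \<epsilon> \<and>
          (AE \<omega> in M. \<forall>i. gft U (x t \<omega>) i = a i t * (gft U (x0 \<omega>) i + q t * gft U (\<epsilon> \<omega>) i))) \<and>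
       (\<forall>i. has_cond_variance M (\<lambda>\<omega>. gft U (x t \<omega>) i) (\<lambda>\<omega>. gft U (x0 \<omega>) i)
              (\<lambda>_. (a i t)\<^sup>2 * (q t)\<^sup>2))) \<and>
     (\<forall>t\<in>{0..t_max}.
       (\<forall>\<omega>. xt t \<omega> = matrix_inv (A t) *v x t \<omega>) \<and>
       (\<forall>i. has_cond_variance M (\<lambda>\<omega>. gft U (xt t \<omega>) i) (\<lambda>\<omega>. gft U (xt 0 \<omega>) i)
              (\<lambda>_. (q t)\<^sup>2)))"
proof -
  interpret prob_space M by (rule M)
  define m where "m = max_eigenvalue (normalized_laplacian G)"
  have m: "0 < m" using lam_max by (simp add: m_def)
  have L: "normalized_laplacian G = conj_diag U lam"
    by (simp add: eigendecomposition conj_diag_def)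
  \<comment> \<open>Each \<open>lam i\<close> is an eigenvalue of the Laplacian, with eigenvector
    \<open>column i U\<close>.\<close>
  have lam: "0 \<le> lam i" for i
    using normalized_laplacian_eigenvalue_nonneg[OF graph] column_eigenvector_conj_diag[OF U]
    unfolding L by blast
  have \<mu>_pos: "0 < \<mu> i" for i using lam[of i] m \<delta> by (simp add: \<mu> add_nonneg_pos flip: m_def)
  have L\<delta>: "shifted_laplacian \<delta> G = conj_diag U \<mu>"
    using conj_diag_affine[OF U, of \<delta> "1 / m" lam]
    by (simp add: shifted_laplacian_def L \<mu>[abs_def] add.commute flip: m_def L)
  have d_pos: "0 < 1 + \<mu> i * (q t)\<^sup>2 / \<sigma>\<^sup>2" for i t
    using \<mu>_pos[of i] by (simp add: add_pos_nonneg)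
  have a_pos: "0 < a i t" for i t using d_pos[of i t] by (simp add: a)
  have At: "A t = conj_diag U (\<lambda>i. a i t)" for t
    using conj_diag_affine[OF U, of 1 "(q t)\<^sup>2 / \<sigma>\<^sup>2" \<mu>]
      spd_inv_sqrt_conj_diag[OF U, of "\<lambda>i. 1 + \<mu> i * (q t)\<^sup>2 / \<sigma>\<^sup>2"] d_pos
    by (simp add: A L\<delta> a mult.commute)
  have q_eq: "q = (\<lambda>t. \<kappa> * t)" using q by blast
  have "deriv q t = \<kappa>" for t
    unfolding q_eq by (rule DERIV_imp_deriv) (auto intro!: derivative_eq_intros)
  then have sde': "solves_sde M B (\<lambda>s. sqrt (2 * (\<kappa> * s) * \<kappa>)) t_max x0 xt"
    using sde by (simp add: q)
  have x0m [measurable]: "x0 \<in> borel_measurable M" using x0 by (simp add: indep_of_process_def)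
  have xtm [measurable]: "xt t \<in> borel_measurable M" if "t \<in> {0..t_max}" for t
    using sde that by (simp add: solves_sde_def)
  have xt0: "AE \<omega> in M. xt 0 \<omega> = x0 \<omega>" using sde by (simp add: solves_sde_def)
  have gft_x: "gft U (x t \<omega>) i = a i t * gft U (xt t \<omega>) i" for t \<omega> i
    by (simp add: x At gft_conj_diag[OF U])

  \<comment> \<open>Eigenvectors of \<open>A t\<close> and of the shifted Laplacian\<close>
  have eigenvectors: "(\<forall>i. is_eigenvector (shifted_laplacian \<delta> G) (column i U) (\<mu> i) \<and>
            is_eigenvector (A t) (column i U) (a i t)) \<and>
       (\<forall>v. (\<exists>c. is_eigenvector (shifted_laplacian \<delta> G) v c) \<longrightarrow> (\<exists>c. is_eigenvector (A t) v c)) \<and>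
       (0 < t \<longrightarrow>
         (\<forall>v. (\<exists>c. is_eigenvector (A t) v c) \<longrightarrow> (\<exists>c. is_eigenvector (shifted_laplacian \<delta> G) v c)))"
    for t
  proof (intro conjI allI impI)
    show "is_eigenvector (shifted_laplacian \<delta> G) (column i U) (\<mu> i)"
      "is_eigenvector (A t) (column i U) (a i t)" for i
      using column_eigenvector_conj_diag[OF U, of \<mu> i]
        column_eigenvector_conj_diag[OF U, of "\<lambda>i. a i t" i] by (simp_all add: L\<delta> At)
  next
    fix v assume "\<exists>c. is_eigenvector (shifted_laplacian \<delta> G) v c"
    then obtain c where "v \<noteq> 0" "\<And>i. gft U v i \<noteq> 0 \<Longrightarrow> \<mu> i = c"
      by (auto simp: L\<delta> is_eigenvector_conj_diag[OF U])
    then show "\<exists>c. is_eigenvector (A t) v c"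
      \<comment> \<open>All modes present in \<open>v\<close> share the value
        \<open>\<mu> i = c\<close>, so the function defining \<open>a i t\<close>, evaluated at
        \<open>c\<close>, is the common eigenvalue.\<close>
      by (intro exI[of _ "(1 + c * (q t)\<^sup>2 / \<sigma>\<^sup>2) powr (- 1 / 2)"])
        (simp add: At is_eigenvector_conj_diag[OF U] a)
  next
    fix v assume t: "0 < t" and "\<exists>c. is_eigenvector (A t) v c"
    then obtain c where "v \<noteq> 0" and c: "\<And>i. gft U v i \<noteq> 0 \<Longrightarrow> a i t = c"
      by (auto simp: At is_eigenvector_conj_diag[OF U])
    then obtain j where j: "gft U v j \<noteq> 0"
      using gft_inject[OF U, of v 0] by (auto simp: gft_eq_inner)
    have "\<mu> i = \<mu> j" if "gft U v i \<noteq> 0" for i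
    proof -
      have "a i t = a j t" using c[OF that] c[OF j] by simp
      \<comment> \<open>The power -2 undoes the exponent -1/2 on a positive base; afterwards
        \<open>\<mu>\<close> can be isolated because \<open>q t\<close> is nonzero for
        \<open>0 < t\<close>.\<close>
      then have "(a i t) powr (- 2) = (a j t) powr (- 2)" by simp
      then have "1 + \<mu> i * (q t)\<^sup>2 / \<sigma>\<^sup>2 = 1 + \<mu> j * (q t)\<^sup>2 / \<sigma>\<^sup>2"
        using d_pos[of i t] d_pos[of j t] by (simp add: a powr_powr)
      then show ?thesis using t \<kappa> \<sigma> by (simp add: q)
    qed
    then show "\<exists>c. is_eigenvector (shifted_laplacian \<delta> G) v c"
      using \<open>v \<noteq> 0\<close> by (intro exI[of _ "\<mu> j"]) (simp add: L\<delta> is_eigenvector_conj_diag[OF U])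
  qed

  \<comment> \<open>Noise representation and conditional variances\<close>
  have noise: "(\<exists>\<epsilon> :: 'a \<Rightarrow> real^'n.
          isotropic_normal M 1 \<epsilon> \<and> indep_var borel x0 borel \<epsilon> \<and>
          (AE \<omega> in M. \<forall>i. gft U (x t \<omega>) i = a i t * (gft U (x0 \<omega>) i + q t * gft U (\<epsilon> \<omega>) i))) \<and>
       (\<forall>i. has_cond_variance M (\<lambda>\<omega>. gft U (x t \<omega>) i) (\<lambda>\<omega>. gft U (x0 \<omega>) i)
              (\<lambda>_. (a i t)\<^sup>2 * (q t)\<^sup>2)) \<and>
       (\<forall>i. has_cond_variance M (\<lambda>\<omega>. gft U (xt t \<omega>) i) (\<lambda>\<omega>. gft U (xt 0 \<omega>) i)
              (\<lambda>_. (q t)\<^sup>2))"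
    if t: "t \<in> {0..t_max}" for t
  proof -
    obtain \<epsilon> :: "'a \<Rightarrow> real^'n" where \<epsilon>: "isotropic_normal M 1 \<epsilon>"
      and indep: "indep_var borel x0 borel \<epsilon>"
      and "AE \<omega> in M. xt t \<omega> = x0 \<omega> + (\<kappa> * t) *\<^sub>R \<epsilon> \<omega>"
      by (rule variance_exploding_representation[OF B x0 \<kappa> sde' t])
    then have xt_eq: "AE \<omega> in M. \<forall>i. gft U (xt t \<omega>) i = gft U (x0 \<omega>) i + q t * gft U (\<epsilon> \<omega>) i"
      by (auto simp: gft_add gft_scaleR q elim!: eventually_mono)
    then have x_eq: "AE \<omega> in M. \<forall>i. gft U (x t \<omega>) i = a i t * (gft U (x0 \<omega>) i + q t * gft U (\<epsilon> \<omega>) i)"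
      by eventually_elim (simp add: gft_x)
    have [measurable]: "\<epsilon> \<in> borel_measurable M" using indep by (rule indep_var_rv2)
    have [measurable]: "xt t \<in> borel_measurable M" "xt 0 \<in> borel_measurable M"
      using t t_max by (auto intro!: xtm)
    have [measurable]: "(\<lambda>\<omega>. gft U (x t \<omega>) i) \<in> borel_measurable M" for i
      unfolding gft_x by measurable
    have "has_cond_variance M (\<lambda>\<omega>. gft U (x t \<omega>) i) (\<lambda>\<omega>. gft U (x0 \<omega>) i)
        (\<lambda>_. (a i t * q t)\<^sup>2)" for i
    proof (rule has_cond_variance_cong_AE[OF _ _ _ _ _ _ has_cond_variance_gft[OF U \<epsilon> indep, of "a i t"]])
      show "AE \<omega> in M. gft U (x t \<omega>) i = a i t * gft U (x0 \<omega>) i + (a i t * q t) * gft U (\<epsilon> \<omega>) i"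
        using x_eq by eventually_elim (simp add: algebra_simps)
    qed auto
    moreover have "has_cond_variance M (\<lambda>\<omega>. gft U (xt t \<omega>) i) (\<lambda>\<omega>. gft U (xt 0 \<omega>) i)
        (\<lambda>_. (q t)\<^sup>2)" for i
    \<comment> \<open>Conjugate coordinates drop the factor \<open>a i t\<close>, so the
      coefficients are 1 and \<open>q t\<close>. The conditioning variable comes from
      \<open>xt 0\<close>, which equals \<open>x0\<close> only almost surely.\<close>
    proof (rule has_cond_variance_cong_AE[OF _ _ _ _ _ _ has_cond_variance_gft[OF U \<epsilon> indep, of 1]])
      show "AE \<omega> in M. gft U (xt t \<omega>) i = 1 * gft U (x0 \<omega>) i + q t * gft U (\<epsilon> \<omega>) i"
        using xt_eq by eventually_elim simp
      show "AE \<omega> in M. gft U (xt 0 \<omega>) i = gft U (x0 \<omega>) i"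
        using xt0 by eventually_elim simp
    qed auto
    ultimately show ?thesis
      using \<epsilon> indep x_eq by (auto simp: power_mult_distrib)
  qed

  have "xt t \<omega> = matrix_inv (A t) *v x t \<omega>" for t \<omega>
  proof -
    have "a i t \<noteq> 0" for i using a_pos[of i t] by simp
    then show ?thesis
      by (intro gft_inject[OF U]) (simp add: At matrix_inv_conj_diag[OF U] gft_conj_diag[OF U] gft_x)
  qed
  then show ?thesis using eigenvectors noise by blast
qed

end
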